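(* Let $A$ be a group with a finite normal subgroup $H \lhd A$ such that $A/H \cong \mathbb{Z}^n$, for some $n \in \mathbb{N}\cup\{0\}$, and let $\xi: A \to \mathbb{Z}^n$ be the quotient map. Suppose that $a_1,\dots,a_m, b_1,\dots,b_m$ are infinite order elements in $A$ such that the $\xi$-images of these elements form a nearly linearly independent collection in $\mathbb{Z}^n$. Then the multiple HNN-extension $$G = \langle A, t_1,\dots,t_m \mid t_i a_i t_i^{-1} = b_i,~ i = 1,\dots,m \rangle$$ has (VRC).
   Context: A subgroup $H$ of a group $G$ is a virtual retract of $G$ if there is a finite index subgroup $K$ of $G$ such that $H \subseteq K$ and there is a homomorphism $\rho: K \to H$ whose restriction to $H$ is the identity map. A group has property (VRC) if every cyclic subgroup is a virtual retract. A collection (indexed family, repetitions allowed) $\{\vec v_i\}_{i \in I}$ of vectors in $\mathbb{R}^n$ is nearly linearly independent if there exists a subset $J \subseteq I$ such that the vectors $\{\vec v_j\}_{j \in J}$ are linearly independent in $\mathbb{R}^n$ and for each $i \in I$ there exist $j \in J$ and $\varepsilon \in \{\pm 1\}$ such that $\vec v_i = \varepsilon\, \vec v_j$. Elements of a finitely generated abelian group $B$ are nearly linearly independent if their images in $B \otimes_{\mathbb{Z}} \mathbb{R}$ are nearly linearly independent; for $B = \mathbb{Z}^n$ this is $\mathbb{Z}^n \subset \mathbb{R}^n$. *)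

theory Defs
  imports
    "HOL-Algebra.Product_Groups"
    "HOL-Algebra.Multiplicative_Group"
    "Jordan_Normal_Form.VS_Connect"
begin

section \<open>Virtual retracts and property (VRC)\<close>

definition virtual_retract :: "('g, 'b) monoid_scheme \<Rightarrow> 'g set \<Rightarrow> bool" where
  "virtual_retract G H \<longleftrightarrow>
     subgroup H G \<and>
     (\<exists>K. subgroup K G \<and> finite (rcosets\<^bsub>G\<^esub> K) \<and> H \<subseteq> K \<and>
        (\<exists>\<rho> \<in> hom (G\<lparr>carrier := K\<rparr>) (G\<lparr>carrier := H\<rparr>). \<forall>h\<in>H. \<rho> h = h))"

definition VRC :: "('g, 'b) monoid_scheme \<Rightarrow> bool" where
  "VRC G \<longleftrightarrow> (\<forall>g\<in>carrier G. virtual_retract G (generate G {g}))"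


section \<open>The lattice and near linear independence\<close>

definition int_lattice :: "nat \<Rightarrow> (nat \<Rightarrow> int) monoid" where
  "int_lattice n = product_group {..<n} (\<lambda>_. integer_group)"

definition real_vec_of :: "nat \<Rightarrow> (nat \<Rightarrow> int) \<Rightarrow> real vec" where
  "real_vec_of n x = vec n (\<lambda>k. real_of_int (x k))"

text \<open>Linear independence of an indexed family: \<^const>\<open>module.lin_dep\<close> speaks about sets, so
  repeated members of the family are excluded by injectivity.\<close>

definition lin_indep_family :: "nat \<Rightarrow> 'i set \<Rightarrow> ('i \<Rightarrow> real vec) \<Rightarrow> bool" where
  "lin_indep_family n J v \<longleftrightarrow>
     inj_on v J \<and> v ` J \<subseteq> carrier_vec n \<and>
     \<not> module.lin_dep class_ring (module_vec TYPE(real) n) (v ` J)"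

definition nearly_lin_indep :: "nat \<Rightarrow> 'i set \<Rightarrow> ('i \<Rightarrow> real vec) \<Rightarrow> bool" where
  "nearly_lin_indep n I v \<longleftrightarrow>
     (\<exists>J\<subseteq>I. lin_indep_family n J v \<and>
        (\<forall>i\<in>I. \<exists>j\<in>J. v i = v j \<or> v i = - v j))"


section \<open>Group presentations\<close>

text \<open>A word is a list of signed generators: \<open>(x, True)\<close> stands for \<open>x\<close> and \<open>(x, False)\<close>
  for its formal inverse. A pair \<open>(u, v)\<close> of words in the set of relations stands for
  the relation \<open>u = v\<close>. The group with generators \<open>X\<close> and relations \<open>R\<close> consists of the words
  over \<open>X\<close> modulo the smallest congruence for concatenation that contains \<open>R\<close> and free
  cancellation.\<close>

type_synonym 'x word = "('x \<times> bool) list"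

abbreviation words :: "'x set \<Rightarrow> 'x word set" where
  "words X \<equiv> lists (X \<times> UNIV)"

inductive pres_eq :: "'x set \<Rightarrow> ('x word \<times> 'x word) set \<Rightarrow> 'x word \<Rightarrow> 'x word \<Rightarrow> bool"
  for X :: "'x set" and R :: "('x word \<times> 'x word) set"
where
  refl: "w \<in> words X \<Longrightarrow> pres_eq X R w w"
| sym: "pres_eq X R u v \<Longrightarrow> pres_eq X R v u"
| trans: "pres_eq X R u v \<Longrightarrow> pres_eq X R v w \<Longrightarrow> pres_eq X R u w"
| append: "pres_eq X R u u' \<Longrightarrow> pres_eq X R v v' \<Longrightarrow> pres_eq X R (u @ v) (u' @ v')"
| cancel: "x \<in> X \<Longrightarrow> pres_eq X R [(x, e), (x, \<not> e)] []"
| rel: "(u, v) \<in> R \<Longrightarrow> u \<in> words X \<Longrightarrow> v \<in> words X \<Longrightarrow> pres_eq X R u v"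

definition pres_class :: "'x set \<Rightarrow> ('x word \<times> 'x word) set \<Rightarrow> 'x word \<Rightarrow> 'x word set" where
  "pres_class X R w = {u. pres_eq X R w u}"

definition presented_group :: "'x set \<Rightarrow> ('x word \<times> 'x word) set \<Rightarrow> 'x word set monoid" where
  "presented_group X R =
     \<lparr>carrier = pres_class X R ` words X,
      monoid.mult = (\<lambda>P Q. \<Union>u\<in>P. \<Union>v\<in>Q. pres_class X R (u @ v)),
      one = pres_class X R []\<rparr>"

lemma pres_eq_words: "pres_eq X R u v \<Longrightarrow> u \<in> words X \<and> v \<in> words X"
  by (induction rule: pres_eq.induct) auto

lemma pres_class_eq_iff:
  assumes "u \<in> words X"
  shows "pres_class X R u = pres_class X R v \<longleftrightarrow> pres_eq X R u v"
proof
  assume "pres_class X R u = pres_class X R v"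
  moreover have "u \<in> pres_class X R u"
    using assms by (simp add: pres_class_def pres_eq.refl)
  ultimately show "pres_eq X R u v"
    by (auto simp: pres_class_def intro: pres_eq.sym)
next
  assume "pres_eq X R u v"
  then show "pres_class X R u = pres_class X R v"
    unfolding pres_class_def by (blast intro: pres_eq.sym pres_eq.trans)
qed

lemma presented_group_mult:
  assumes "u \<in> words X" "v \<in> words X"
  shows "pres_class X R u \<otimes>\<^bsub>presented_group X R\<^esub> pres_class X R v = pres_class X R (u @ v)"
proof -
  have "pres_class X R (u' @ v') = pres_class X R (u @ v)"
    if "u' \<in> pres_class X R u" "v' \<in> pres_class X R v" for u' v'
  proof -
    have "pres_eq X R (u @ v) (u' @ v')"
      using that by (auto simp: pres_class_def intro: pres_eq.append)
    then have "pres_class X R (u @ v) = pres_class X R (u' @ v')"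
      using pres_class_eq_iff pres_eq_words by metis
    then show ?thesis by simp
  qed
  moreover have "u \<in> pres_class X R u" "v \<in> pres_class X R v"
    using assms by (simp_all add: pres_class_def pres_eq.refl)
  ultimately have "(\<Union>u'\<in>pres_class X R u. \<Union>v'\<in>pres_class X R v. pres_class X R (u' @ v'))
      = pres_class X R (u @ v)"
    by blast
  then show ?thesis
    by (simp add: presented_group_def)
qed

definition word_inv :: "'x word \<Rightarrow> 'x word" where
  "word_inv w = rev (map (\<lambda>(x, e). (x, \<not> e)) w)"

lemma word_inv_in_words: "w \<in> words X \<Longrightarrow> word_inv w \<in> words X"
  by (auto simp: word_inv_def)

lemma word_inv_cancel: "w \<in> words X \<Longrightarrow> pres_eq X R (word_inv w @ w) []"
proof (induction w)
  case Nil
  then show ?case by (simp add: word_inv_def pres_eq.refl)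
next
  case (Cons a w)
  obtain x e where a: "a = (x, e)" by force
  have x: "x \<in> X" and w: "w \<in> words X" using Cons.prems a by auto
  have "pres_eq X R ([(x, \<not> e), (x, e)] @ w) ([] @ w)"
    using pres_eq.append[OF pres_eq.cancel[OF x, of R "\<not> e"] pres_eq.refl[OF w]] by simp
  then have "pres_eq X R (word_inv w @ ([(x, \<not> e), (x, e)] @ w)) (word_inv w @ w)"
    using pres_eq.append[OF pres_eq.refl[OF word_inv_in_words[OF w]]] by fastforce
  then show ?case
    using Cons.IH[OF w] pres_eq.trans by (fastforce simp: a word_inv_def)
qed

lemma group_presented_group: "group (presented_group X R)"
proof -
  let ?G = "presented_group X R"
  have car: "carrier ?G = pres_class X R ` words X"
    and one: "\<one>\<^bsub>?G\<^esub> = pres_class X R []"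
    by (simp_all add: presented_group_def)
  show ?thesis
  proof (rule groupI)
    fix P assume "P \<in> carrier ?G"
    then obtain w where w: "w \<in> words X" "P = pres_class X R w"
      by (auto simp: car)
    have "pres_class X R (word_inv w @ w) = pres_class X R []"
      using w word_inv_cancel pres_class_eq_iff pres_eq_words by blast
    then have "pres_class X R (word_inv w) \<otimes>\<^bsub>?G\<^esub> P = \<one>\<^bsub>?G\<^esub>"
      using w by (simp add: presented_group_mult word_inv_in_words one)
    then show "\<exists>Q\<in>carrier ?G. Q \<otimes>\<^bsub>?G\<^esub> P = \<one>\<^bsub>?G\<^esub>"
      using word_inv_in_words[OF w(1)] unfolding car by blast
  next
    fix P Q S assume "P \<in> carrier ?G" "Q \<in> carrier ?G" "S \<in> carrier ?G"
    then obtain u v w where "u \<in> words X" "v \<in> words X" "w \<in> words X"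
      "P = pres_class X R u" "Q = pres_class X R v" "S = pres_class X R w"
      unfolding car by blast
    then show "P \<otimes>\<^bsub>?G\<^esub> Q \<otimes>\<^bsub>?G\<^esub> S = P \<otimes>\<^bsub>?G\<^esub> (Q \<otimes>\<^bsub>?G\<^esub> S)"
      by (simp add: presented_group_mult)
  next
    fix P Q assume "P \<in> carrier ?G" "Q \<in> carrier ?G"
    then obtain u v where "u \<in> words X" "v \<in> words X"
      "P = pres_class X R u" "Q = pres_class X R v"
      unfolding car by blast
    then show "P \<otimes>\<^bsub>?G\<^esub> Q \<in> carrier ?G"
      by (simp add: presented_group_mult car)
  next
    show "\<one>\<^bsub>?G\<^esub> \<in> carrier ?G" by (simp add: car one)
  next
    fix P assume "P \<in> carrier ?G"
    then obtain u where "u \<in> words X" "P = pres_class X R u"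
      unfolding car by blast
    then show "\<one>\<^bsub>?G\<^esub> \<otimes>\<^bsub>?G\<^esub> P = P"
      by (simp add: presented_group_mult one)
  qed
qed


section \<open>Multiple HNN-extensions\<close>

datatype 'a hnn_gen = Base 'a | Stable nat

text \<open>The relative presentation \<open>\<langle>A, t\<^sub>1, \<dots>, t\<^sub>m | t\<^sub>i a\<^sub>i t\<^sub>i\<^sup>-\<^sup>1 = b\<^sub>i\<rangle>\<close>: the group \<open>A\<close> is
  presented by all of its elements and its multiplication table.\<close>

definition hnn_gens :: "('a, 'c) monoid_scheme \<Rightarrow> nat \<Rightarrow> 'a hnn_gen set" where
  "hnn_gens A m = Base ` carrier A \<union> Stable ` {1..m}"

definition hnn_rels ::
    "('a, 'c) monoid_scheme \<Rightarrow> nat \<Rightarrow> (nat \<Rightarrow> 'a) \<Rightarrow> (nat \<Rightarrow> 'a)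
      \<Rightarrow> ('a hnn_gen word \<times> 'a hnn_gen word) set" where
  "hnn_rels A m a b =
     {([(Base x, True), (Base y, True)], [(Base (x \<otimes>\<^bsub>A\<^esub> y), True)]) | x y.
        x \<in> carrier A \<and> y \<in> carrier A} \<union>
     {([(Stable i, True), (Base (a i), True), (Stable i, False)], [(Base (b i), True)]) | i.
        i \<in> {1..m}}"

definition multiple_HNN ::
    "('a, 'c) monoid_scheme \<Rightarrow> nat \<Rightarrow> (nat \<Rightarrow> 'a) \<Rightarrow> (nat \<Rightarrow> 'a)
      \<Rightarrow> 'a hnn_gen word set monoid" where
  "multiple_HNN A m a b = presented_group (hnn_gens A m) (hnn_rels A m a b)"

lemma group_multiple_HNN: "group (multiple_HNN A m a b)"
  by (simp add: multiple_HNN_def group_presented_group)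

end

theory Submission
  imports Defs "HOL-Combinatorics.Permutations"
begin

text \<open>
  If a finite set \<open>\<Omega>\<close> carries an action of \<open>G\<close> on \<open>\<Omega> \<times> \<int>\<close> by permutations commuting with the
  translations, and \<open>g\<close> sends \<open>(\<omega>, 0)\<close> to \<open>(\<omega>, l)\<close> with \<open>l \<noteq> 0\<close>, then the displacement is a
  character of the stabiliser of \<open>\<omega>\<close>; on the finite index subgroup where \<open>l\<close> divides it, it splits
  off the cyclic subgroup of \<open>g\<close>. Such actions of the HNN-extension are written down from
  generators and relations, without any normal form theorem.

  Near linear independence gives integral functionals \<open>x\<^sub>k\<close> with joint kernel \<open>H\<close> such that every
  \<open>a\<^sub>i\<close>, \<open>b\<^sub>i\<close> has exactly one nonzero coordinate, equal to \<open>\<plusminus>D\<close> with a common \<open>D\<close>. Elements of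
  \<open>A\<close> outside \<open>H\<close> are detected by letting \<open>A\<close> translate by the functionals \<open>\<plusminus>x\<^sub>k\<close> and \<open>t\<^sub>i\<close> permute
  these. Moreover \<open>A\<close> has finite quotients \<open>Q\<close>, injective on \<open>H\<close>, in which all \<open>a\<^sub>i\<close> and \<open>b\<^sub>i\<close>
  have the same order and which separate finitely many elements from the cyclic subgroups of the
  \<open>a\<^sub>i\<close>, \<open>b\<^sub>i\<close>. On a disjoint union of copies of \<open>Q\<close> every partial matching of
  \<open>a\<^sub>i\<close>-orbits with \<open>b\<^sub>i\<close>-orbits extends to an action of \<open>t\<^sub>i\<close>. This detects the elements of \<open>H\<close>, and
  for a cyclically reduced word the matchings can be chosen so that the word runs once around a
  cycle of copies. Every other element is conjugate to one of these.
\<close>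

section \<open>Criteria for virtual retracts\<close>

lemma (in group) finite_rcosetsI:
  assumes "subgroup L G" "finite T" "T \<subseteq> carrier G"
    and "\<And>x. x \<in> carrier G \<Longrightarrow> \<exists>y\<in>T. x \<otimes> inv y \<in> L"
  shows "finite (rcosets L)"
proof -
  have "rcosets L \<subseteq> (\<lambda>y. L #> y) ` T"
  proof
    fix C assume "C \<in> rcosets L"
    then obtain x where x: "x \<in> carrier G" "C = L #> x"
      by (auto simp: RCOSETS_def)
    then obtain y where y: "y \<in> T" "x \<otimes> inv y \<in> L"
      using assms(4) by blast
    have yc: "y \<in> carrier G" using y assms(3) by blast
    have "(x \<otimes> inv y) \<otimes> y = x"
      using x yc by (simp add: m_assoc)
    then have "x \<in> L #> y"
      using y unfolding r_coset_def by force
    then have "L #> x = L #> y"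
      using repr_independence[of x L y] assms(1) yc by simp
    then show "C \<in> (\<lambda>y. L #> y) ` T" using x y by blast
  qed
  then show ?thesis using assms(2) finite_surj by blast
qed

text \<open>One representative per value of \<open>\<kappa>\<close> meets every coset. The
  invariants used later are image cosets and points with residues.\<close>

lemma (in group) finite_rcosets_fibres:
  assumes L: "subgroup L G" and fin: "finite (\<kappa> ` carrier G)"
    and eq: "\<And>x y. \<lbrakk>x \<in> carrier G; y \<in> carrier G; \<kappa> x = \<kappa> y\<rbrakk> \<Longrightarrow> x \<otimes> inv y \<in> L"
  shows "finite (rcosets L)"
proof (rule finite_rcosetsI[OF L])
  let ?r = "\<lambda>c. SOME y. y \<in> carrier G \<and> \<kappa> y = c"
  have r: "?r (\<kappa> x) \<in> carrier G \<and> \<kappa> (?r (\<kappa> x)) = \<kappa> x" if "x \<in> carrier G" for x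
    using that by (intro someI[of "\<lambda>y. y \<in> carrier G \<and> \<kappa> y = \<kappa> x"]) auto
  show "finite (?r ` \<kappa> ` carrier G)" using fin by blast
  show "?r ` \<kappa> ` carrier G \<subseteq> carrier G" using r by auto
  show "\<exists>y\<in>?r ` \<kappa> ` carrier G. x \<otimes> inv y \<in> L" if "x \<in> carrier G" for x
    using that eq[OF that, of "?r (\<kappa> x)"] r[OF that] by (intro bexI[of _ "?r (\<kappa> x)"]) auto
qed

lemma (in group) generate_singleton:
  assumes "g \<in> carrier G"
  shows "generate G {g} = range (\<lambda>k::int. g [^] k)"
  using generate_pow[OF assms] by auto

lemma virtual_retractI:
  assumes "subgroup H G" "subgroup K G" "finite (rcosets\<^bsub>G\<^esub> K)" "H \<subseteq> K"
    and "\<rho> \<in> hom (G\<lparr>carrier := K\<rparr>) (G\<lparr>carrier := H\<rparr>)" "\<forall>h\<in>H. \<rho> h = h"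
  shows "virtual_retract G H"
  unfolding virtual_retract_def
  by (intro conjI exI[of _ K] bexI[of _ \<rho>]) (fact assms)+

text \<open>The retraction is \<open>x \<mapsto> g [^] \<chi> x\<close>; since
  \<open>\<chi> g = 1\<close>, the exponent of each power of \<open>g\<close> is recovered by
  \<open>\<chi>\<close>.\<close>

lemma (in group) virtual_retract_of_character:
  assumes g: "g \<in> L" and L: "subgroup L G" "finite (rcosets L)"
    and \<chi>: "\<And>x y. \<lbrakk>x \<in> L; y \<in> L\<rbrakk> \<Longrightarrow> \<chi> (x \<otimes> y) = \<chi> x + (\<chi> y :: int)" "\<chi> g = 1"
  shows "virtual_retract G (generate G {g})"
proof -
  interpret L: subgroup L G by fact
  have gc: "g \<in> carrier G" using g by auto
  have one: "\<chi> \<one> = 0" using \<chi>(1)[of \<one> \<one>] by simp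
  have nat: "g [^] (k::nat) \<in> L \<and> \<chi> (g [^] k) = int k" for k
    by (induction k) (use g \<chi> one in auto)
  have inv: "\<chi> (inv x) = - \<chi> x" if "x \<in> L" for x
    using \<chi>(1)[of x "inv x"] one that by auto
  have pow: "g [^] k \<in> L \<and> \<chi> (g [^] k) = k" for k :: int
  proof (cases k)
    case (nonneg n)
    then show ?thesis using nat[of n] by (simp only: int_pow_int)
  next
    case (neg n)
    then have "g [^] k = inv (g [^] Suc n)"
      using int_pow_neg[OF gc, of "int (Suc n)"] by (simp only: int_pow_int)
    then show ?thesis using nat[of "Suc n"] inv L.m_inv_closed neg by metis
  qed
  let ?H = "generate G {g}"
  have "(\<lambda>x. g [^] \<chi> x) \<in> hom (G\<lparr>carrier := L\<rparr>) (G\<lparr>carrier := ?H\<rparr>)"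
    by (rule homI) (auto simp: generate_singleton[OF gc] \<chi> int_pow_mult[OF gc])
  moreover have "\<forall>h\<in>?H. g [^] \<chi> h = h"
    using pow by (auto simp: generate_singleton[OF gc])
  moreover have "?H \<subseteq> L" using pow by (auto simp: generate_singleton[OF gc])
  ultimately show ?thesis
    by (intro virtual_retractI[OF generate_is_subgroup L]) (use gc in auto)
qed

text \<open>On the preimage of \<open>K\<close>, the map \<open>\<Phi>\<close> is followed by the
  retraction in \<open>S\<close> and by the inverse of \<open>\<Phi>\<close> on the cyclic subgroup
  of \<open>g\<close>. Injectivity is asked on powers of \<open>g\<close> only, in a form that
  covers finite and infinite order alike.\<close>

lemma virtual_retract_pullback:
  assumes "group G" "group S" and \<Phi>: "\<Phi> \<in> hom G S" and g: "g \<in> carrier G"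
    and vr: "virtual_retract S (generate S {\<Phi> g})"
    and inj: "\<And>k::int. \<Phi> g [^]\<^bsub>S\<^esub> k = \<one>\<^bsub>S\<^esub> \<Longrightarrow> g [^]\<^bsub>G\<^esub> k = \<one>\<^bsub>G\<^esub>"
  shows "virtual_retract G (generate G {g})"
proof -
  interpret G: group G by fact
  interpret S: group S by fact
  interpret h: group_hom G S \<Phi> using \<Phi> by unfold_locales
  have pg: "\<Phi> g \<in> carrier S" using g by simp
  have pow: "\<Phi> (g [^]\<^bsub>G\<^esub> k) = \<Phi> g [^]\<^bsub>S\<^esub> k" for k :: int
    using h.hom_int_pow[OF g] .
  have eqI: "g [^]\<^bsub>G\<^esub> j = g [^]\<^bsub>G\<^esub> k" if "\<Phi> g [^]\<^bsub>S\<^esub> j = \<Phi> g [^]\<^bsub>S\<^esub> k" for j k :: int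
  proof -
    have "\<Phi> g [^]\<^bsub>S\<^esub> (j - k) = \<one>\<^bsub>S\<^esub>" using that pg S.r_inv[OF S.int_pow_closed[OF pg]] by (simp add: S.int_pow_diff)
    then have "g [^]\<^bsub>G\<^esub> (j - k) = \<one>\<^bsub>G\<^esub>" by (rule inj)
    moreover have "g [^]\<^bsub>G\<^esub> j = g [^]\<^bsub>G\<^esub> (j - k) \<otimes>\<^bsub>G\<^esub> g [^]\<^bsub>G\<^esub> k"
      using g by (simp flip: G.int_pow_mult)
    ultimately show ?thesis using g by simp
  qed
  obtain K \<rho> where K: "subgroup K S" "finite (rcosets\<^bsub>S\<^esub> K)" "generate S {\<Phi> g} \<subseteq> K"
    and \<rho>: "\<rho> \<in> hom (S\<lparr>carrier := K\<rparr>) (S\<lparr>carrier := generate S {\<Phi> g}\<rparr>)" "\<forall>h\<in>generate S {\<Phi> g}. \<rho> h = h"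
    using vr unfolding virtual_retract_def by blast
  define L where "L = {x \<in> carrier G. \<Phi> x \<in> K}"
  have L: "subgroup L G"
    unfolding L_def
    by (rule G.subgroupI) (use K(1) in \<open>auto simp: subgroup_def\<close>)
  have fin: "finite (rcosets\<^bsub>G\<^esub> L)"
  proof (rule G.finite_rcosets_fibres[OF L])
    show "finite ((\<lambda>x. K #>\<^bsub>S\<^esub> \<Phi> x) ` carrier G)"
      by (rule finite_subset[OF _ K(2)]) (auto simp: RCOSETS_def intro!: h.hom_closed)
    fix x y assume xy: "x \<in> carrier G" "y \<in> carrier G" "K #>\<^bsub>S\<^esub> \<Phi> x = K #>\<^bsub>S\<^esub> \<Phi> y"
    have "\<Phi> x \<in> K #>\<^bsub>S\<^esub> \<Phi> y"
      using xy S.rcos_self[OF _ K(1)] by (metis h.hom_closed)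
    then obtain k where "k \<in> K" "\<Phi> x = k \<otimes>\<^bsub>S\<^esub> \<Phi> y" by (auto simp: r_coset_def)
    then have "\<Phi> (x \<otimes>\<^bsub>G\<^esub> inv\<^bsub>G\<^esub> y) = k"
      using xy K(1) subgroup.mem_carrier by (fastforce simp: S.m_assoc)
    then show "x \<otimes>\<^bsub>G\<^esub> inv\<^bsub>G\<^esub> y \<in> L" using \<open>k \<in> K\<close> xy by (simp add: L_def)
  qed
  \<comment> \<open>An exponent is determined only up to the order of \<open>\<Phi> g\<close>;
    \<open>eqI\<close> turns equal powers of \<open>\<Phi> g\<close> into equal powers of
    \<open>g\<close>, so the choice is harmless.\<close>
  define e where "e s = (SOME k::int. \<Phi> g [^]\<^bsub>S\<^esub> k = s)" for s
  have e: "\<Phi> g [^]\<^bsub>S\<^esub> e s = s" if "s \<in> generate S {\<Phi> g}" for s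
    using that unfolding e_def S.generate_singleton[OF pg] by (auto intro: someI)
  have rho_in: "\<rho> x \<in> generate S {\<Phi> g}" if "x \<in> K" for x
    using \<rho>(1) that by (auto simp: hom_def)
  define \<sigma> where "\<sigma> x = g [^]\<^bsub>G\<^esub> e (\<rho> (\<Phi> x))" for x
  have "\<sigma> \<in> hom (G\<lparr>carrier := L\<rparr>) (G\<lparr>carrier := generate G {g}\<rparr>)"
  proof (rule homI)
    fix x assume "x \<in> carrier (G\<lparr>carrier := L\<rparr>)"
    then show "\<sigma> x \<in> carrier (G\<lparr>carrier := generate G {g}\<rparr>)"
      by (simp add: \<sigma>_def G.generate_singleton[OF g])
  next
    fix x y assume "x \<in> carrier (G\<lparr>carrier := L\<rparr>)" "y \<in> carrier (G\<lparr>carrier := L\<rparr>)"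
    then have xy: "x \<in> carrier G" "\<Phi> x \<in> K" "y \<in> carrier G" "\<Phi> y \<in> K" by (auto simp: L_def)
    have "\<rho> (\<Phi> (x \<otimes>\<^bsub>G\<^esub> y)) = \<rho> (\<Phi> x) \<otimes>\<^bsub>S\<^esub> \<rho> (\<Phi> y)"
      using xy \<rho>(1) by (auto simp: hom_def)
    moreover have "\<Phi> x \<otimes>\<^bsub>S\<^esub> \<Phi> y \<in> K" using xy K(1) by (simp add: subgroup.m_closed)
    ultimately have "\<Phi> g [^]\<^bsub>S\<^esub> e (\<rho> (\<Phi> (x \<otimes>\<^bsub>G\<^esub> y)))
        = \<Phi> g [^]\<^bsub>S\<^esub> (e (\<rho> (\<Phi> x)) + e (\<rho> (\<Phi> y)))"
      using xy rho_in e pg by (simp add: S.int_pow_mult generate.eng)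
    from eqI[OF this] show "\<sigma> (x \<otimes>\<^bsub>G\<lparr>carrier := L\<rparr>\<^esub> y) = \<sigma> x \<otimes>\<^bsub>G\<lparr>carrier := generate G {g}\<rparr>\<^esub> \<sigma> y"
      using g by (simp add: \<sigma>_def G.int_pow_mult)
  qed
  moreover have mem: "\<Phi> g [^]\<^bsub>S\<^esub> k \<in> generate S {\<Phi> g}" for k :: int
    by (auto simp: S.generate_singleton[OF pg])
  have "\<forall>h\<in>generate G {g}. \<sigma> h = h"
    by (auto simp: \<sigma>_def G.generate_singleton[OF g] pow \<rho>(2) mem e intro!: eqI)
  moreover have "generate G {g} \<subseteq> L"
    using mem K(3) g by (auto simp: L_def G.generate_singleton[OF g] pow)
  ultimately show ?thesis
    by (intro virtual_retractI[OF G.generate_is_subgroup L fin]) (use g in auto)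
qed

lemma (in group) conj_hom:
  assumes x: "x \<in> carrier G"
  shows "(\<lambda>z. x \<otimes> z \<otimes> inv x) \<in> hom G G"
proof (rule homI)
  fix y z assume yz: "y \<in> carrier G" "z \<in> carrier G"
  have "inv x \<otimes> (x \<otimes> (z \<otimes> inv x)) = z \<otimes> inv x"
    using x yz by (simp flip: m_assoc)
  then show "x \<otimes> (y \<otimes> z) \<otimes> inv x = x \<otimes> y \<otimes> inv x \<otimes> (x \<otimes> z \<otimes> inv x)"
    using x yz by (simp add: m_assoc)
qed (use x in simp)

text \<open>Conjugation by \<open>x\<close> is injective and takes \<open>y \<otimes> x\<close> to
  \<open>x \<otimes> y\<close>. Conjugacy invariance in this form fits the rotation of
  words.\<close>

lemma (in group) virtual_retract_conj:
  assumes x: "x \<in> carrier G" and y: "y \<in> carrier G"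
    and vr: "virtual_retract G (generate G {x \<otimes> y})"
  shows "virtual_retract G (generate G {y \<otimes> x})"
proof (rule virtual_retract_pullback[where \<Phi> = "\<lambda>z. x \<otimes> z \<otimes> inv x"])
  show hom: "(\<lambda>z. x \<otimes> z \<otimes> inv x) \<in> hom G G"
    using x by (rule conj_hom)
  have eq: "x \<otimes> (y \<otimes> x) \<otimes> inv x = x \<otimes> y"
    using x y by (simp add: m_assoc)
  show "virtual_retract G (generate G {x \<otimes> (y \<otimes> x) \<otimes> inv x})"
    using vr by (simp add: eq)
  fix k :: int
  interpret h: group_hom G G "\<lambda>z. x \<otimes> z \<otimes> inv x" using hom by unfold_locales
  assume "(x \<otimes> (y \<otimes> x) \<otimes> inv x) [^] k = \<one>"
  then have "x \<otimes> ((y \<otimes> x) [^] k) \<otimes> inv x = \<one>"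
    using h.hom_int_pow[of "y \<otimes> x" k] x y by simp
  moreover have "x \<otimes> ((y \<otimes> x) [^] k) = x \<otimes> ((y \<otimes> x) [^] k) \<otimes> inv x \<otimes> x"
    using x y by (simp add: m_assoc)
  ultimately have "x \<otimes> ((y \<otimes> x) [^] k) = x \<otimes> \<one>"
    using x by simp
  then show "(y \<otimes> x) [^] k = \<one>"
    using x y by (simp del: r_one)
qed (use x y is_group in auto)

lemma (in group) virtual_retract_finite:
  assumes "finite (carrier G)" "subgroup K G"
  shows "virtual_retract G K"
proof -
  have "finite (rcosets K)" using assms(1) by (simp add: RCOSETS_def)
  moreover have "(\<lambda>x. x) \<in> hom (G\<lparr>carrier := K\<rparr>) (G\<lparr>carrier := K\<rparr>)" by (simp add: hom_def)
  ultimately show ?thesis by (intro virtual_retractI[OF assms(2) assms(2)]) auto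
qed

section \<open>Permutation groups\<close>

definition perm_group :: "'w set \<Rightarrow> ('w \<Rightarrow> 'w) monoid" where
  "perm_group \<Omega> = \<lparr>carrier = {p. p permutes \<Omega>}, monoid.mult = (\<circ>), one = id\<rparr>"

lemma perm_group_simps [simp]:
  "carrier (perm_group \<Omega>) = {p. p permutes \<Omega>}"
  "p \<otimes>\<^bsub>perm_group \<Omega>\<^esub> q = p \<circ> q"
  "\<one>\<^bsub>perm_group \<Omega>\<^esub> = id"
  by (simp_all add: perm_group_def)

lemma group_perm_group: "group (perm_group \<Omega>)"
  by (rule groupI)
    (auto intro: permutes_compose permutes_id simp: comp_assoc dest: permutes_inv permutes_inv_o(2))

text \<open>The permutations of \<open>\<Omega> \<times> \<int>\<close> that commute with the translations of the second factor.\<close>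

definition shift_perm :: "('w \<Rightarrow> 'w) \<Rightarrow> ('w \<Rightarrow> int) \<Rightarrow> 'w \<times> int \<Rightarrow> 'w \<times> int" where
  "shift_perm p c = (\<lambda>(\<omega>, z). (p \<omega>, z + c \<omega>))"

definition shift_group :: "'w set \<Rightarrow> ('w \<times> int \<Rightarrow> 'w \<times> int) monoid" where
  "shift_group \<Omega> = \<lparr>carrier = {shift_perm p c | p c. p permutes \<Omega>}, monoid.mult = (\<circ>), one = id\<rparr>"

lemma shift_perm_apply [simp]: "shift_perm p c (\<omega>, z) = (p \<omega>, z + c \<omega>)"
  by (simp add: shift_perm_def)

lemma shift_perm_comp: "shift_perm p c \<circ> shift_perm q d = shift_perm (p \<circ> q) (\<lambda>\<omega>. d \<omega> + c (q \<omega>))"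
  by (auto simp: fun_eq_iff)

lemma shift_perm_id: "shift_perm id (\<lambda>_. 0) = id"
  by (auto simp: fun_eq_iff)

lemma carrier_shift_group: "carrier (shift_group \<Omega>) = {shift_perm p c | p c. p permutes \<Omega>}"
  by (simp add: shift_group_def)

lemma shift_perm_in_carrier: "p permutes \<Omega> \<Longrightarrow> shift_perm p c \<in> carrier (shift_group \<Omega>)"
  by (auto simp: carrier_shift_group)

lemma shift_group_simps [simp]:
  "f \<otimes>\<^bsub>shift_group \<Omega>\<^esub> g = f \<circ> g"
  "\<one>\<^bsub>shift_group \<Omega>\<^esub> = id"
  by (simp_all add: shift_group_def)

lemma group_shift_group: "group (shift_group \<Omega>)"
proof (rule groupI)
  fix f g assume "f \<in> carrier (shift_group \<Omega>)" "g \<in> carrier (shift_group \<Omega>)"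
  then obtain p c q d where "f = shift_perm p c" "g = shift_perm q d" "p permutes \<Omega>" "q permutes \<Omega>"
    by (auto simp: carrier_shift_group)
  then have "f \<circ> g = shift_perm (p \<circ> q) (\<lambda>\<omega>. d \<omega> + c (q \<omega>))" "p \<circ> q permutes \<Omega>"
    by (simp_all add: shift_perm_comp permutes_compose)
  then show "f \<otimes>\<^bsub>shift_group \<Omega>\<^esub> g \<in> carrier (shift_group \<Omega>)" by (simp add: shift_perm_in_carrier)
next
  show "\<one>\<^bsub>shift_group \<Omega>\<^esub> \<in> carrier (shift_group \<Omega>)"
    using shift_perm_in_carrier[OF permutes_id] by (simp flip: shift_perm_id)
next
  fix f assume "f \<in> carrier (shift_group \<Omega>)"
  then obtain p c where f: "f = shift_perm p c" "p permutes \<Omega>" by (auto simp: carrier_shift_group)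
  have "shift_perm (inv_into UNIV p) (\<lambda>\<omega>. - c (inv_into UNIV p \<omega>)) \<circ> f = id"
    using f by (auto simp: fun_eq_iff permutes_inverses)
  then show "\<exists>g\<in>carrier (shift_group \<Omega>). g \<otimes>\<^bsub>shift_group \<Omega>\<^esub> f = \<one>\<^bsub>shift_group \<Omega>\<^esub>"
    using shift_perm_in_carrier[OF permutes_inv[OF f(2)]] by auto
qed (auto simp: comp_assoc)

lemma shift_group_translate:
  assumes "f \<in> carrier (shift_group \<Omega>)"
  shows "f (\<omega>, z + y) = (fst (f (\<omega>, z)), snd (f (\<omega>, z)) + y)"
  using assms by (auto simp: carrier_shift_group)

lemma virtual_retract_shift_group:
  assumes fin: "finite \<Omega>" and f: "f \<in> carrier (shift_group \<Omega>)" and \<omega>: "\<omega> \<in> \<Omega>"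
    and fix_pt: "f (\<omega>, 0) = (\<omega>, l)" and l: "l \<noteq> 0"
  shows "virtual_retract (shift_group \<Omega>) (generate (shift_group \<Omega>) {f})"
proof -
  let ?S = "shift_group \<Omega>"
  interpret S: group ?S by (rule group_shift_group)
  \<comment> \<open>\<open>L\<close> is the stabiliser of the set of all
    \<open>(\<omega>, k * l)\<close>, and \<open>\<chi> g\<close> is the number of steps of length
    \<open>l\<close> by which \<open>g\<close> moves it.\<close>
  define L where "L = {g \<in> carrier ?S. fst (g (\<omega>, 0)) = \<omega> \<and> l dvd snd (g (\<omega>, 0))}"
  define \<chi> where "\<chi> g = snd (g (\<omega>, 0)) div l" for g :: "'a \<times> int \<Rightarrow> 'a \<times> int"
  have L_app: "g (\<omega>, z) = (\<omega>, z + \<chi> g * l)" if "g \<in> L" for g z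
    using that shift_group_translate[of g \<Omega> \<omega> 0 z] by (auto simp: L_def \<chi>_def)
  have L_I: "g \<in> L" if "g \<in> carrier ?S" "g (\<omega>, z) = (\<omega>, z + k * l)" for g z k
  proof -
    have "g (\<omega>, z) = (fst (g (\<omega>, 0)), snd (g (\<omega>, 0)) + z)"
      using shift_group_translate[OF that(1), of \<omega> 0 z] by simp
    then have "fst (g (\<omega>, 0)) = \<omega>" "snd (g (\<omega>, 0)) = k * l" using that by auto
    then show ?thesis using that by (simp add: L_def)
  qed
  have inv_app: "g ((inv\<^bsub>?S\<^esub> g) x) = x" if "g \<in> carrier ?S" for g x
    using S.r_inv[OF that] by (metis comp_apply id_apply shift_group_simps)
  have inv_app': "(inv\<^bsub>?S\<^esub> g) (g x) = x" if "g \<in> carrier ?S" for g x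
    using S.l_inv[OF that] by (metis comp_apply id_apply shift_group_simps)
  have L: "subgroup L ?S"
  proof (rule S.subgroupI)
    show "L \<subseteq> carrier ?S" by (auto simp: L_def)
    have "id \<in> L" using S.one_closed by (simp add: L_def)
    then show "L \<noteq> {}" by blast
    fix g assume g: "g \<in> L"
    then have gc: "g \<in> carrier ?S" by (simp add: L_def)
    show "inv\<^bsub>?S\<^esub> g \<in> L"
    proof (rule L_I[where z = "\<chi> g * l" and k = "- \<chi> g"])
      show "inv\<^bsub>?S\<^esub> g \<in> carrier ?S" using gc by (rule S.inv_closed)
      show "(inv\<^bsub>?S\<^esub> g) (\<omega>, \<chi> g * l) = (\<omega>, \<chi> g * l + - \<chi> g * l)"
        using inv_app'[OF gc, of "(\<omega>, 0)"] L_app[OF g, of 0] by simp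
    qed
    fix h assume h: "h \<in> L"
    show "g \<otimes>\<^bsub>?S\<^esub> h \<in> L"
      using S.m_closed[OF gc, of h] h L_app[OF g] L_app[OF h]
      by (intro L_I[where z = 0 and k = "\<chi> h + \<chi> g"]) (auto simp: L_def algebra_simps)
  qed
  show ?thesis
  proof (rule S.virtual_retract_of_character[OF _ L])
    show "f \<in> L" using f fix_pt by (simp add: L_def)
    show "\<chi> f = 1" using fix_pt l by (simp add: \<chi>_def)
    show "\<chi> (g \<otimes>\<^bsub>?S\<^esub> h) = \<chi> g + \<chi> h" if "g \<in> L" "h \<in> L" for g h
    proof -
      have "(g \<circ> h) (\<omega>, 0) = (\<omega>, (\<chi> g + \<chi> h) * l)"
        using L_app[OF that(1)] L_app[OF that(2)] by (simp add: algebra_simps)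
      then show ?thesis using l by (simp add: \<chi>_def)
    qed
    \<comment> \<open>A right coset of \<open>L\<close> is determined by where the inverses of its
      members send \<open>(\<omega>, 0)\<close>, the integer being taken modulo
      \<open>l\<close>.\<close>
    let ?\<kappa> = "\<lambda>g. (fst ((inv\<^bsub>?S\<^esub> g) (\<omega>, 0)), snd ((inv\<^bsub>?S\<^esub> g) (\<omega>, 0)) mod l)"
    show "finite (rcosets\<^bsub>?S\<^esub> L)"
    proof (rule S.finite_rcosets_fibres[OF L, where \<kappa> = ?\<kappa>])
      have "?\<kappa> g \<in> \<Omega> \<times> {- \<bar>l\<bar>..\<bar>l\<bar>}" if g: "g \<in> carrier ?S" for g
      proof -
        obtain p c where "inv\<^bsub>?S\<^esub> g = shift_perm p c" "p permutes \<Omega>"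
          using S.inv_closed[OF g] by (auto simp: carrier_shift_group)
        \<comment> \<open>For negative \<open>l\<close> the residues are not positive, hence a
          symmetric range.\<close>
        moreover have "z mod l \<in> {- \<bar>l\<bar>..\<bar>l\<bar>}" for z
          using abs_mod_less[OF l, of z] by auto
        ultimately show ?thesis using \<omega> by (simp add: permutes_in_image)
      qed
      then show "finite (?\<kappa> ` carrier ?S)"
        using fin by (auto intro: finite_subset[of _ "\<Omega> \<times> {- \<bar>l\<bar>..\<bar>l\<bar>}"])
      fix g h assume g: "g \<in> carrier ?S" and h: "h \<in> carrier ?S" and eq: "?\<kappa> g = ?\<kappa> h"
      obtain \<omega>' z where z: "(inv\<^bsub>?S\<^esub> g) (\<omega>, 0) = (\<omega>', z)" by fastforce
      then obtain z' where z': "(inv\<^bsub>?S\<^esub> h) (\<omega>, 0) = (\<omega>', z')"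
        using eq by (cases "(inv\<^bsub>?S\<^esub> h) (\<omega>, 0)") simp
      have "z mod l = z' mod l" using eq z z' by simp
      then have "l dvd z' - z" by (metis mod_eq_dvd_iff)
      then obtain k where k: "z' = z + k * l"
        by (auto simp: dvd_def algebra_simps)
      note zz = z z'
      have "g (\<omega>', z') = (\<omega>, 0 + k * l)"
        using shift_group_translate[OF g, of \<omega>' z "k * l"] inv_app[OF g, of "(\<omega>, 0)"] zz k by simp
      then show "g \<otimes>\<^bsub>?S\<^esub> inv\<^bsub>?S\<^esub> h \<in> L"
        using zz S.m_closed[OF g S.inv_closed[OF h]] by (intro L_I[where z = 0 and k = k]) auto
    qed
  qed
qed

text \<open>The \<open>k\<close>-th power of \<open>\<Phi> g\<close> moves
  \<open>(\<omega>, 0)\<close> by \<open>k * l\<close>, so only \<open>k = 0\<close> gives the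
  identity and the retract can be pulled back.\<close>

lemma virtual_retract_shift_action:
  assumes G: "group G" and \<Phi>: "\<Phi> \<in> hom G (shift_group \<Omega>)" and g: "g \<in> carrier G"
    and fin: "finite \<Omega>" and \<omega>: "\<omega> \<in> \<Omega>" and fix_pt: "\<Phi> g (\<omega>, 0) = (\<omega>, l)" and l: "l \<noteq> 0"
  shows "virtual_retract G (generate G {g})"
proof (rule virtual_retract_pullback[OF G group_shift_group \<Phi> g])
  let ?S = "shift_group \<Omega>"
  interpret S: group ?S by (rule group_shift_group)
  have \<Phi>g: "\<Phi> g \<in> carrier ?S" using \<Phi> g by (rule hom_in_carrier)
  show "virtual_retract ?S (generate ?S {\<Phi> g})"
    using virtual_retract_shift_group[OF fin \<Phi>g \<omega> fix_pt l] .
  have app: "\<Phi> g (\<omega>, z) = (\<omega>, z + l)" for z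
    using shift_group_translate[OF \<Phi>g, of \<omega> 0 z] fix_pt by simp
  have nat: "(\<Phi> g [^]\<^bsub>?S\<^esub> n) (\<omega>, z) = (\<omega>, z + int n * l)" for n :: nat and z
    by (induction n arbitrary: z) (simp_all add: app algebra_simps)
  fix k :: int assume "\<Phi> g [^]\<^bsub>?S\<^esub> k = \<one>\<^bsub>?S\<^esub>"
  then have "\<Phi> g [^]\<^bsub>?S\<^esub> (nat \<bar>k\<bar>) = \<one>\<^bsub>?S\<^esub>"
    using S.int_pow_neg[OF \<Phi>g, of k] S.inv_one by (cases "k \<ge> 0") (auto simp flip: int_pow_int)
  then have "int (nat \<bar>k\<bar>) * l = 0"
    using nat[of "nat \<bar>k\<bar>" 0] by simp
  then have "k = 0" using l by simp
  then show "g [^]\<^bsub>G\<^esub> k = \<one>\<^bsub>G\<^esub>" by simp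
qed

section \<open>Homomorphisms out of a presentation\<close>

definition word_val :: "('s, 'b) monoid_scheme \<Rightarrow> ('x \<Rightarrow> 's) \<Rightarrow> 'x word \<Rightarrow> 's" where
  "word_val S f w = foldr (\<lambda>(x, e) y. (if e then f x else inv\<^bsub>S\<^esub> f x) \<otimes>\<^bsub>S\<^esub> y) w \<one>\<^bsub>S\<^esub>"

lemma word_val_simps [simp]:
  "word_val S f [] = \<one>\<^bsub>S\<^esub>"
  "word_val S f ((x, e) # w) = (if e then f x else inv\<^bsub>S\<^esub> f x) \<otimes>\<^bsub>S\<^esub> word_val S f w"
  by (simp_all add: word_val_def)

context group
begin

lemma word_val_closed: "f \<in> X \<rightarrow> carrier G \<Longrightarrow> w \<in> words X \<Longrightarrow> word_val G f w \<in> carrier G"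
  by (induction w) (auto simp: Pi_iff)

lemma word_val_append:
  "f \<in> X \<rightarrow> carrier G \<Longrightarrow> u \<in> words X \<Longrightarrow> v \<in> words X \<Longrightarrow>
    word_val G f (u @ v) = word_val G f u \<otimes> word_val G f v"
proof (induction u)
  case Nil
  then show ?case by (simp add: word_val_closed)
next
  case (Cons y u)
  moreover have "word_val G f u \<in> carrier G" "word_val G f v \<in> carrier G"
    using Cons.prems by (auto intro: word_val_closed)
  ultimately show ?case by (cases y) (auto simp: m_assoc Pi_iff)
qed

lemma word_val_cong:
  assumes f: "f \<in> X \<rightarrow> carrier G"
    and rel: "\<And>u v. \<lbrakk>(u, v) \<in> R; u \<in> words X; v \<in> words X\<rbrakk> \<Longrightarrow> word_val G f u = word_val G f v"
  shows "pres_eq X R u v \<Longrightarrow> word_val G f u = word_val G f v"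
proof (induction rule: pres_eq.induct)
  case (append u u' v v')
  then show ?case using word_val_append[OF f] pres_eq_words by metis
next
  case (cancel x e)
  then have "f x \<in> carrier G" using f by auto
  then show ?case by simp
qed (simp_all add: rel)

end

text \<open>Universal property of a presentation: a class gets the value of a chosen representative,
  and \<open>word_val_cong\<close> makes it independent of the choice.\<close>

lemma presented_group_lift:
  assumes S: "group S" and f: "f \<in> X \<rightarrow> carrier S"
    and rel: "\<And>u v. \<lbrakk>(u, v) \<in> R; u \<in> words X; v \<in> words X\<rbrakk> \<Longrightarrow> word_val S f u = word_val S f v"
  obtains \<Phi> where "\<Phi> \<in> hom (presented_group X R) S"
    "\<And>w. w \<in> words X \<Longrightarrow> \<Phi> (pres_class X R w) = word_val S f w"
proof -
  interpret S: group S by fact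
  define \<Phi> where "\<Phi> P = word_val S f (SOME w. w \<in> P)" for P
  have \<Phi>: "\<Phi> (pres_class X R w) = word_val S f w" if "w \<in> words X" for w
  proof -
    have "w \<in> pres_class X R w" using that by (simp add: pres_class_def pres_eq.refl)
    then have "(SOME u. u \<in> pres_class X R w) \<in> pres_class X R w" by (rule someI)
    then have "pres_eq X R w (SOME u. u \<in> pres_class X R w)" by (simp add: pres_class_def)
    from S.word_val_cong[OF f rel this] show ?thesis by (simp add: \<Phi>_def)
  qed
  have "\<Phi> \<in> hom (presented_group X R) S"
  proof (rule homI)
    fix P assume "P \<in> carrier (presented_group X R)"
    then obtain w where "w \<in> words X" "P = pres_class X R w"
      by (auto simp: presented_group_def)
    then show "\<Phi> P \<in> carrier S"
      using \<Phi> S.word_val_closed[OF f] by simp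
  next
    fix P Q assume "P \<in> carrier (presented_group X R)" "Q \<in> carrier (presented_group X R)"
    then obtain u v where "P = pres_class X R u" "u \<in> words X" "Q = pres_class X R v" "v \<in> words X"
      by (auto simp: presented_group_def)
    then show "\<Phi> (P \<otimes>\<^bsub>presented_group X R\<^esub> Q) = \<Phi> P \<otimes>\<^bsub>S\<^esub> \<Phi> Q"
      by (simp add: presented_group_mult \<Phi> S.word_val_append[OF f])
  qed
  then show ?thesis using \<Phi> that by blast
qed

lemma pres_class_in_carrier: "w \<in> words X \<Longrightarrow> pres_class X R w \<in> carrier (presented_group X R)"
  by (simp add: presented_group_def)

lemma inv_pres_class:
  assumes "x \<in> X"
  shows "inv\<^bsub>presented_group X R\<^esub> (pres_class X R [(x, True)]) = pres_class X R [(x, False)]"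
proof -
  interpret group "presented_group X R" by (rule group_presented_group)
  have "pres_class X R [(x, False), (x, True)] = pres_class X R []"
    using pres_eq.cancel[OF assms, of R False] assms by (subst pres_class_eq_iff) auto
  then have "pres_class X R [(x, False)] \<otimes>\<^bsub>presented_group X R\<^esub> pres_class X R [(x, True)]
      = \<one>\<^bsub>presented_group X R\<^esub>"
    using assms by (simp add: presented_group_mult) (simp add: presented_group_def)
  then show ?thesis
    using assms by (intro inv_equality) (auto intro: pres_class_in_carrier)
qed

section \<open>Multiple HNN-extensions\<close>

text \<open>Conjugation by \<open>t\<close> is a homomorphism taking \<open>x\<close> to
  \<open>y\<close>. The case \<open>x = y\<close> serves for commuting elements.\<close>

lemma (in group) intertwine_int_pow:
  assumes "t \<in> carrier G" "x \<in> carrier G" "y \<in> carrier G" "t \<otimes> x = y \<otimes> t"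
  shows "t \<otimes> x [^] (k::int) = y [^] k \<otimes> t"
proof -
  interpret h: group_hom G G "\<lambda>z. t \<otimes> z \<otimes> inv t"
    using conj_hom[OF assms(1)] by unfold_locales
  have "y = t \<otimes> x \<otimes> inv t" using assms by (simp add: m_assoc)
  then have "y [^] k = t \<otimes> x [^] k \<otimes> inv t"
    using h.hom_int_pow[OF assms(2), of k] by simp
  then show ?thesis using assms by (simp add: m_assoc)
qed

text \<open>A list of syllables \<open>(i, e, \<alpha>)\<close> stands for the product of the elements
  \<open>t\<^sub>i\<^sup>\<plusminus>\<^sup>1 \<alpha>\<close>, the sign being positive if \<open>e\<close> holds.\<close>

definition syl_val ::
    "('s, 'b) monoid_scheme \<Rightarrow> ('a \<Rightarrow> 's) \<Rightarrow> (nat \<Rightarrow> 's) \<Rightarrow> (nat \<times> bool \<times> 'a) list \<Rightarrow> 's" where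
  "syl_val S \<theta> \<tau> l =
     foldr (\<lambda>(i, e, \<alpha>) y. (if e then \<tau> i else inv\<^bsub>S\<^esub> \<tau> i) \<otimes>\<^bsub>S\<^esub> (\<theta> \<alpha> \<otimes>\<^bsub>S\<^esub> y)) l \<one>\<^bsub>S\<^esub>"

lemma syl_val_simps [simp]:
  "syl_val S \<theta> \<tau> [] = \<one>\<^bsub>S\<^esub>"
  "syl_val S \<theta> \<tau> ((i, e, \<alpha>) # l)
    = (if e then \<tau> i else inv\<^bsub>S\<^esub> \<tau> i) \<otimes>\<^bsub>S\<^esub> (\<theta> \<alpha> \<otimes>\<^bsub>S\<^esub> syl_val S \<theta> \<tau> l)"
  by (simp_all add: syl_val_def)

locale hnn_extension = A: group A
  for A :: "('a, 'c) monoid_scheme" (structure) +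
  fixes m :: nat and a b :: "nat \<Rightarrow> 'a"
  assumes a_closed: "i \<in> {1..m} \<Longrightarrow> a i \<in> carrier A"
    and b_closed: "i \<in> {1..m} \<Longrightarrow> b i \<in> carrier A"
begin

abbreviation G where "G \<equiv> multiple_HNN A m a b"

definition \<iota> where "\<iota> x = pres_class (hnn_gens A m) (hnn_rels A m a b) [(Base x, True)]"
definition t where "t i = pres_class (hnn_gens A m) (hnn_rels A m a b) [(Stable i, True)]"

sublocale G: group G by (rule group_multiple_HNN)

lemma base_gen: "x \<in> carrier A \<Longrightarrow> Base x \<in> hnn_gens A m"
  and stable_gen: "i \<in> {1..m} \<Longrightarrow> Stable i \<in> hnn_gens A m"
  by (auto simp: hnn_gens_def)

lemma \<iota>_closed: "x \<in> carrier A \<Longrightarrow> \<iota> x \<in> carrier G"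
  by (simp add: \<iota>_def multiple_HNN_def pres_class_in_carrier base_gen)

lemma t_closed: "i \<in> {1..m} \<Longrightarrow> t i \<in> carrier G"
  unfolding t_def multiple_HNN_def by (rule pres_class_in_carrier) (auto simp: stable_gen)

lemma \<iota>_hom: "\<iota> \<in> hom A G"
proof (rule homI)
  fix x y assume xy: "x \<in> carrier A" "y \<in> carrier A"
  let ?X = "hnn_gens A m" and ?R = "hnn_rels A m a b"
  have "pres_eq ?X ?R [(Base x, True), (Base y, True)] [(Base (x \<otimes> y), True)]"
    by (rule pres_eq.rel) (use xy in \<open>auto simp: hnn_rels_def base_gen\<close>)
  then have "pres_class ?X ?R [(Base x, True), (Base y, True)] = pres_class ?X ?R [(Base (x \<otimes> y), True)]"
    by (subst pres_class_eq_iff) (use xy in \<open>auto simp: base_gen\<close>)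
  then show "\<iota> (x \<otimes> y) = \<iota> x \<otimes>\<^bsub>G\<^esub> \<iota> y"
    using xy by (simp add: \<iota>_def multiple_HNN_def presented_group_mult base_gen)
qed (rule \<iota>_closed)

sublocale \<iota>: group_hom A G \<iota>
  by unfold_locales (rule \<iota>_hom)

lemma t_rel:
  assumes i: "i \<in> {1..m}"
  shows "t i \<otimes>\<^bsub>G\<^esub> \<iota> (a i) = \<iota> (b i) \<otimes>\<^bsub>G\<^esub> t i"
proof -
  let ?X = "hnn_gens A m" and ?R = "hnn_rels A m a b"
  let ?u = "[(Stable i, True), (Base (a i), True), (Stable i, False)]"
  have gens: "Stable i \<in> ?X" "Base (a i) \<in> ?X" "Base (b i) \<in> ?X"
    using i by (simp_all add: stable_gen base_gen a_closed b_closed)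
  have "pres_eq ?X ?R ?u [(Base (b i), True)]"
    by (rule pres_eq.rel) (use i gens in \<open>auto simp: hnn_rels_def\<close>)
  then have "pres_class ?X ?R ?u = \<iota> (b i)"
    unfolding \<iota>_def by (subst pres_class_eq_iff) (use gens in auto)
  moreover have "pres_class ?X ?R ?u = t i \<otimes>\<^bsub>G\<^esub> \<iota> (a i) \<otimes>\<^bsub>G\<^esub> inv\<^bsub>G\<^esub> t i"
    using gens by (simp add: t_def \<iota>_def multiple_HNN_def presented_group_mult inv_pres_class)
  ultimately show ?thesis
    using i by (metis G.inv_solve_right G.m_closed \<iota>_closed a_closed b_closed t_closed)
qed

text \<open>Universal property of the HNN-extension. As an intertwining, the relation becomes an
  equation between compositions of permutations, without inverses.\<close>

lemma lift:
  assumes S: "group S" and \<theta>: "\<theta> \<in> hom A S" and \<tau>: "\<And>i. i \<in> {1..m} \<Longrightarrow> \<tau> i \<in> carrier S"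
    and rel: "\<And>i. i \<in> {1..m} \<Longrightarrow> \<tau> i \<otimes>\<^bsub>S\<^esub> \<theta> (a i) = \<theta> (b i) \<otimes>\<^bsub>S\<^esub> \<tau> i"
  obtains \<Phi> where "\<Phi> \<in> hom G S" "\<And>x. x \<in> carrier A \<Longrightarrow> \<Phi> (\<iota> x) = \<theta> x"
    "\<And>i. i \<in> {1..m} \<Longrightarrow> \<Phi> (t i) = \<tau> i"
proof -
  interpret S: group S by fact
  define f where "f = case_hnn_gen \<theta> \<tau>"
  have \<theta>c: "\<theta> x \<in> carrier S" if "x \<in> carrier A" for x
    using \<theta> that by (rule hom_in_carrier)
  have f: "f \<in> hnn_gens A m \<rightarrow> carrier S"
    by (auto simp: f_def hnn_gens_def \<theta>c \<tau>)
  have "word_val S f u = word_val S f v" if "(u, v) \<in> hnn_rels A m a b" for u v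
    using that unfolding hnn_rels_def
  proof (elim UnE CollectE exE conjE)
    fix x y assume "(u, v) = ([(Base x, True), (Base y, True)], [(Base (x \<otimes> y), True)])"
      "x \<in> carrier A" "y \<in> carrier A"
    then show ?thesis using \<theta> by (simp add: f_def hom_mult \<theta>c)
  next
    fix i assume uv: "(u, v) = ([(Stable i, True), (Base (a i), True), (Stable i, False)], [(Base (b i), True)])"
      and i: "i \<in> {1..m}"
    have "\<tau> i \<otimes>\<^bsub>S\<^esub> \<theta> (a i) \<otimes>\<^bsub>S\<^esub> inv\<^bsub>S\<^esub> \<tau> i = \<theta> (b i)"
      unfolding rel[OF i] using i by (simp add: S.m_assoc \<theta>c \<tau> b_closed)
    then show ?thesis using uv i by (simp add: f_def \<theta>c \<tau> a_closed b_closed S.m_assoc)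
  qed
  then obtain \<Phi> where \<Phi>: "\<Phi> \<in> hom G S"
    "\<And>w. w \<in> words (hnn_gens A m) \<Longrightarrow>
      \<Phi> (pres_class (hnn_gens A m) (hnn_rels A m a b) w) = word_val S f w"
    using presented_group_lift[OF S f, of "hnn_rels A m a b"] unfolding multiple_HNN_def by metis
  show ?thesis
  proof (rule that[OF \<Phi>(1)])
    show "\<Phi> (\<iota> x) = \<theta> x" if "x \<in> carrier A" for x
      using that by (simp add: \<iota>_def \<Phi>(2) base_gen f_def \<theta>c)
    show "\<Phi> (t i) = \<tau> i" if i: "i \<in> {1..m}" for i
      using \<Phi>(2)[of "[(Stable i, True)]"] stable_gen[OF i] \<tau>[OF i] by (simp add: t_def f_def)
  qed
qed

section \<open>Products of syllables and cyclic reduction\<close>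

abbreviation syls :: "(nat \<times> bool \<times> 'a) list set" where
  "syls \<equiv> lists ({1..m} \<times> UNIV \<times> carrier A)"

lemma syl_val_closed:
  assumes "group S" "\<And>x. x \<in> carrier A \<Longrightarrow> \<theta> x \<in> carrier S" "\<And>i. i \<in> {1..m} \<Longrightarrow> \<tau> i \<in> carrier S"
  shows "l \<in> syls \<Longrightarrow> syl_val S \<theta> \<tau> l \<in> carrier S"
proof (induction l)
  interpret S: group S by fact
  case Nil
  then show ?case by simp
next
  interpret S: group S by fact
  case (Cons x l)
  then show ?case using assms by (cases x) auto
qed

lemma hom_syl_val:
  assumes "group S" "\<Phi> \<in> hom G S" "\<And>x. x \<in> carrier A \<Longrightarrow> \<Phi> (\<iota> x) = \<theta> x"
    "\<And>i. i \<in> {1..m} \<Longrightarrow> \<Phi> (t i) = \<tau> i"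
  shows "l \<in> syls \<Longrightarrow> \<Phi> (syl_val G \<iota> t l) = syl_val S \<theta> \<tau> l"
proof (induction l)
  interpret \<Phi>: group_hom G S \<Phi> using assms by (simp add: group_hom_def group_hom_axioms_def G.is_group)
  case Nil
  then show ?case by simp
next
  interpret \<Phi>: group_hom G S \<Phi> using assms by (simp add: group_hom_def group_hom_axioms_def G.is_group)
  case (Cons x l)
  obtain i e \<alpha> where x: "x = (i, e, \<alpha>)" by (cases x)
  have "syl_val G \<iota> t l \<in> carrier G" "i \<in> {1..m}" "\<alpha> \<in> carrier A"
    using Cons.prems x by (auto intro!: syl_val_closed simp: G.is_group \<iota>_closed t_closed)
  moreover have "\<Phi> (syl_val G \<iota> t l) = syl_val S \<theta> \<tau> l" using Cons by simp
  ultimately show ?case using x by (simp add: assms(3,4) t_closed)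
qed

abbreviation val where "val \<equiv> syl_val G \<iota> t"

lemma val_closed [simp]: "l \<in> syls \<Longrightarrow> val l \<in> carrier G"
  by (rule syl_val_closed) (simp_all add: G.is_group \<iota>_closed t_closed)

lemma val_append: "l \<in> syls \<Longrightarrow> l' \<in> syls \<Longrightarrow> val (l @ l') = val l \<otimes>\<^bsub>G\<^esub> val l'"
proof (induction l)
  case Nil
  then show ?case by simp
next
  case (Cons x l)
  obtain i e \<alpha> where x: "x = (i, e, \<alpha>)" by (cases x)
  have "val l \<in> carrier G" "val l' \<in> carrier G" "i \<in> {1..m}" "\<alpha> \<in> carrier A"
    using Cons.prems x by auto
  then show ?case using x Cons by (simp add: t_closed G.m_assoc)
qed

text \<open>Letters are prepended one at a time: a base letter is multiplied into the leading
  element, while a stable letter makes that element part of a new first syllable and leaves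
  \<open>\<one>\<close> in front.\<close>

lemma syl_form:
  assumes "g \<in> carrier G"
  obtains \<alpha> l where "\<alpha> \<in> carrier A" "l \<in> syls" "g = \<iota> \<alpha> \<otimes>\<^bsub>G\<^esub> val l"
proof -
  let ?X = "hnn_gens A m" and ?R = "hnn_rels A m a b"
  have "\<exists>\<alpha> l. \<alpha> \<in> carrier A \<and> l \<in> syls \<and> pres_class ?X ?R w = \<iota> \<alpha> \<otimes>\<^bsub>G\<^esub> val l"
    if "w \<in> words ?X" for w
    using that
  proof (induction w rule: list.induct)
    case Nil
    have "pres_class ?X ?R [] = \<one>\<^bsub>G\<^esub>"
      by (simp add: multiple_HNN_def presented_group_def)
    then have "pres_class ?X ?R [] = \<iota> \<one> \<otimes>\<^bsub>G\<^esub> val []"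
      by simp
    then show ?case by (intro exI[of _ \<one>] exI[of _ "[]"]) simp
  next
    case (Cons y w)
    then obtain \<alpha> l where IH: "\<alpha> \<in> carrier A" "l \<in> syls" "pres_class ?X ?R w = \<iota> \<alpha> \<otimes>\<^bsub>G\<^esub> val l"
      by auto
    obtain x e where y: "y = (x, e)" by (cases y)
    have xX: "x \<in> ?X" using Cons.prems y by simp
    have w: "w \<in> words ?X" using Cons.prems by simp
    have G: "G = presented_group ?X ?R" by (simp add: multiple_HNN_def)
    have "pres_class ?X ?R [(x, e)]
        = (if e then pres_class ?X ?R [(x, True)] else inv\<^bsub>G\<^esub> pres_class ?X ?R [(x, True)])"
      using inv_pres_class[OF xX, of ?R] by (simp add: G)
    then have eq: "pres_class ?X ?R (y # w) =
        (if e then pres_class ?X ?R [(x, True)] else inv\<^bsub>G\<^esub> pres_class ?X ?R [(x, True)])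
          \<otimes>\<^bsub>G\<^esub> (\<iota> \<alpha> \<otimes>\<^bsub>G\<^esub> val l)"
      using presented_group_mult[of "[(x, e)]" ?X w ?R] xX w y IH(3) by (simp add: G)
    consider (base) x' where "x' \<in> carrier A" "x = Base x'" | (stable) i where "i \<in> {1..m}" "x = Stable i"
      using xX by (auto simp: hnn_gens_def)
    then show ?case
    proof cases
      case base
      let ?c = "if e then x' else inv x'"
      have "pres_class ?X ?R (y # w) = \<iota> (?c \<otimes> \<alpha>) \<otimes>\<^bsub>G\<^esub> val l"
        unfolding eq using base IH by (simp add: \<iota>_def[symmetric] G.m_assoc)
      moreover have "?c \<otimes> \<alpha> \<in> carrier A" using base IH by simp
      ultimately show ?thesis using IH(2) by blast
    next
      case stable
      have "pres_class ?X ?R (y # w) = \<iota> \<one> \<otimes>\<^bsub>G\<^esub> val ((i, e, \<alpha>) # l)"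
        unfolding eq using stable IH by (simp add: t_def[symmetric] t_closed)
      moreover have "(i, e, \<alpha>) # l \<in> syls" using stable IH by simp
      ultimately show ?thesis by blast
    qed
  qed
  moreover obtain w where "w \<in> words ?X" "g = pres_class ?X ?R w"
    using assms by (auto simp: multiple_HNN_def presented_group_def)
  ultimately show ?thesis using that by blast
qed

text \<open>A pinch as in Britton's lemma: the element between a stable letter and its inverse lies
  in the associated cyclic subgroup.\<close>

definition cancels :: "nat \<times> bool \<times> 'a \<Rightarrow> nat \<times> bool \<times> 'a \<Rightarrow> bool" where
  "cancels x y \<longleftrightarrow> (\<exists>i e \<alpha> \<beta> k. x = (i, e, \<alpha>) \<and> y = (i, \<not> e, \<beta>) \<and>
     \<alpha> = (if e then a i else b i) [^] (k::int))"

text \<open>The index modulo the length also compares the last syllable with the first.\<close>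

definition cyc_reduced :: "(nat \<times> bool \<times> 'a) list \<Rightarrow> bool" where
  "cyc_reduced l \<longleftrightarrow> (\<forall>s<length l. \<not> cancels (l ! s) (l ! (Suc s mod length l)))"

text \<open>The relation moves the pinched power to the front of the stable letter, which then meets
  its inverse. Two syllables disappear.\<close>

lemma val_cancel:
  assumes "cancels x y" "x # y # l \<in> syls"
  obtains \<alpha> where "\<alpha> \<in> carrier A" "val (x # y # l) = \<iota> \<alpha> \<otimes>\<^bsub>G\<^esub> val l"
proof -
  obtain i e \<alpha> \<beta> k where xy: "x = (i, e, \<alpha>)" "y = (i, \<not> e, \<beta>)"
    "\<alpha> = (if e then a i else b i) [^] (k::int)"
    using assms(1) unfolding cancels_def by blast
  have i: "i \<in> {1..m}" and \<beta>: "\<beta> \<in> carrier A" and l: "l \<in> syls" using assms(2) xy by auto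
  note [simp] = a_closed[OF i] b_closed[OF i] t_closed[OF i]
  have rel: "t i \<otimes>\<^bsub>G\<^esub> \<iota> (a i [^] k) = \<iota> (b i [^] k) \<otimes>\<^bsub>G\<^esub> t i"
    using G.intertwine_int_pow[OF _ _ _ t_rel[OF i], of k] by (simp add: \<iota>.hom_int_pow)
  \<comment> \<open>The same power of the other associated generator.\<close>
  let ?\<gamma> = "(if e then b i else a i) [^] k"
  have "(if e then t i else inv\<^bsub>G\<^esub> t i) \<otimes>\<^bsub>G\<^esub> \<iota> \<alpha> = \<iota> ?\<gamma> \<otimes>\<^bsub>G\<^esub> (if e then t i else inv\<^bsub>G\<^esub> t i)"
  proof (cases e)
    case True
    then show ?thesis using rel xy by simp
  next
    case False
    have "inv\<^bsub>G\<^esub> t i \<otimes>\<^bsub>G\<^esub> \<iota> (b i [^] k)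
        = inv\<^bsub>G\<^esub> t i \<otimes>\<^bsub>G\<^esub> (\<iota> (b i [^] k) \<otimes>\<^bsub>G\<^esub> t i) \<otimes>\<^bsub>G\<^esub> inv\<^bsub>G\<^esub> t i"
      by (simp add: G.m_assoc)
    also have "\<dots> = \<iota> (a i [^] k) \<otimes>\<^bsub>G\<^esub> inv\<^bsub>G\<^esub> t i"
      unfolding rel[symmetric] by (simp add: G.m_assoc[symmetric])
    finally show ?thesis using False xy by simp
  qed
  then have swap: "(if e then t i else inv\<^bsub>G\<^esub> t i) \<otimes>\<^bsub>G\<^esub> (\<iota> \<alpha> \<otimes>\<^bsub>G\<^esub> z)
      = \<iota> ?\<gamma> \<otimes>\<^bsub>G\<^esub> ((if e then t i else inv\<^bsub>G\<^esub> t i) \<otimes>\<^bsub>G\<^esub> z)" if "z \<in> carrier G" for z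
    using that xy by (simp flip: G.m_assoc)
  have "val (x # y # l) = (if e then t i else inv\<^bsub>G\<^esub> t i) \<otimes>\<^bsub>G\<^esub> (\<iota> \<alpha> \<otimes>\<^bsub>G\<^esub>
      ((if e then inv\<^bsub>G\<^esub> t i else t i) \<otimes>\<^bsub>G\<^esub> (\<iota> \<beta> \<otimes>\<^bsub>G\<^esub> val l)))"
    by (simp add: xy(1,2))
  also have "\<dots> = \<iota> ?\<gamma> \<otimes>\<^bsub>G\<^esub> ((if e then t i else inv\<^bsub>G\<^esub> t i) \<otimes>\<^bsub>G\<^esub>
      ((if e then inv\<^bsub>G\<^esub> t i else t i) \<otimes>\<^bsub>G\<^esub> (\<iota> \<beta> \<otimes>\<^bsub>G\<^esub> val l)))"
    using \<beta> l by (intro swap) simp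
  also have "\<dots> = \<iota> ?\<gamma> \<otimes>\<^bsub>G\<^esub> (\<iota> \<beta> \<otimes>\<^bsub>G\<^esub> val l)"
    using \<beta> l by (cases e) (simp_all add: G.m_assoc[symmetric])
  also have "\<dots> = \<iota> (?\<gamma> \<otimes> \<beta>) \<otimes>\<^bsub>G\<^esub> val l"
    using \<beta> l by (simp add: G.m_assoc)
  finally show ?thesis using \<beta> by (intro that[of "?\<gamma> \<otimes> \<beta>"]) auto
qed

text \<open>A base element at the right end is absorbed by the last syllable.\<close>

lemma val_rotate_one:
  assumes "\<alpha> \<in> carrier A" "l \<in> syls" "l \<noteq> []"
  obtains l' where "l' \<in> syls" "length l' = length l" "val l \<otimes>\<^bsub>G\<^esub> \<iota> \<alpha> = val l'"
proof -
  obtain u i e \<beta> where l: "l = u @ [(i, e, \<beta>)]"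
    using assms(3) by (metis prod_cases3 rev_exhaust)
  have mem: "u \<in> syls" "i \<in> {1..m}" "\<beta> \<in> carrier A" using assms(2) l by auto
  have "val l \<otimes>\<^bsub>G\<^esub> \<iota> \<alpha> = val (u @ [(i, e, \<beta> \<otimes> \<alpha>)])"
    using mem assms(1) by (simp add: l val_append t_closed G.m_assoc)
  moreover have "u @ [(i, e, \<beta> \<otimes> \<alpha>)] \<in> syls" using mem assms(1) by simp
  ultimately show ?thesis using that l by (metis length_append_singleton)
qed

text \<open>Induction on the number of syllables. Up to conjugation the leading base element goes to
  the right end and is absorbed; a pinch, possibly across the ends, is rotated to the front and
  cancelled, which shortens the list.\<close>

lemma conj_cases:
  assumes conj: "\<And>x y. \<lbrakk>x \<in> carrier G; y \<in> carrier G; P (x \<otimes>\<^bsub>G\<^esub> y)\<rbrakk> \<Longrightarrow> P (y \<otimes>\<^bsub>G\<^esub> x)"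
    and base: "\<And>\<alpha>. \<alpha> \<in> carrier A \<Longrightarrow> P (\<iota> \<alpha>)"
    and red: "\<And>l. \<lbrakk>l \<in> syls; l \<noteq> []; cyc_reduced l\<rbrakk> \<Longrightarrow> P (val l)"
    and g: "g \<in> carrier G"
  shows "P g"
proof -
  have "P (\<iota> \<alpha> \<otimes>\<^bsub>G\<^esub> val l)" if "\<alpha> \<in> carrier A" "l \<in> syls" for \<alpha> l
    using that
  proof (induction "length l" arbitrary: \<alpha> l rule: less_induct)
    case less
    show ?case
    proof (cases "l = []")
      case True
      then show ?thesis using base less.prems by simp
    next
      case False
      then obtain l' where l': "l' \<in> syls" "length l' = length l" "val l \<otimes>\<^bsub>G\<^esub> \<iota> \<alpha> = val l'"
        using val_rotate_one less.prems by metis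
      have ne: "l' \<noteq> []" using l'(2) False by auto
      have "P (val l')"
      proof (cases "cyc_reduced l'")
        case True
        then show ?thesis using red[OF l'(1) ne] by simp
      next
        case False
        then obtain s where s: "s < length l'" "cancels (l' ! s) (l' ! (Suc s mod length l'))"
          by (auto simp: cyc_reduced_def)
        \<comment> \<open>A single syllable cannot cancel with itself, because the signs would have
          to differ.\<close>
        have "length l' \<noteq> 1"
          using s by (auto simp: cancels_def)
        then have len: "length l' \<ge> 2" using s by linarith
        define l'' where "l'' = rotate s l'"
        have "length l'' \<ge> 2" using len by (simp add: l''_def)
        then obtain x y r where xyr: "l'' = x # y # r"
          by (metis One_nat_def Suc_1 Suc_le_length_iff)
        have "x = l' ! s" "y = l' ! (Suc s mod length l')"
          using nth_rotate[of 0 l' s] nth_rotate[of 1 l' s] s len ne xyr by (auto simp: l''_def[symmetric])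
        then have "cancels x y" using s by simp
        moreover have mem: "x # y # r \<in> syls"
          using l'(1) xyr by (metis in_lists_conv_set l''_def set_rotate)
        ultimately obtain \<gamma> where \<gamma>: "\<gamma> \<in> carrier A" "val (x # y # r) = \<iota> \<gamma> \<otimes>\<^bsub>G\<^esub> val r"
          using val_cancel by blast
        have "length r < length l" using xyr l'(2) by (metis l''_def length_Cons length_rotate less_SucI lessI)
        then have "P (val l'')"
          using less.hyps[of r \<gamma>] \<gamma> mem xyr by simp
        moreover have "l' = take s l' @ drop s l'" "l'' = drop s l' @ take s l'"
          using s by (simp_all add: l''_def rotate_drop_take)
        moreover have "take s l' \<in> syls" "drop s l' \<in> syls"
          using l'(1) by (auto dest: in_set_takeD in_set_dropD)
        ultimately show ?thesis
          using conj[of "val (drop s l')" "val (take s l')"] by (metis val_append val_closed)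
      qed
      then show ?thesis
        using conj[of "val l" "\<iota> \<alpha>"] l'(3) less.prems by simp
    qed
  qed
  then show ?thesis using syl_form[OF g] by metis
qed

end

section \<open>Integral functionals dual to a linearly independent family\<close>

text \<open>Gaussian elimination without division: clearing the column of each new vector multiplies
  the common pivot value \<open>D\<close>.\<close>

lemma dual_functionals:
  fixes v :: "'j \<Rightarrow> nat \<Rightarrow> int"
  assumes "finite J" and "\<And>u. \<forall>k<n. (\<Sum>j\<in>J. u j * v j k) = 0 \<Longrightarrow> \<forall>j\<in>J. u j = 0"
  shows "\<exists>X D \<pi>. D \<noteq> (0::int) \<and> inj_on \<pi> J \<and> \<pi> ` J \<subseteq> {..<n} \<and>
    (\<forall>j\<in>J. \<forall>k<n. (\<Sum>l<n. X k l * v j l) = (if k = \<pi> j then D else 0)) \<and>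
    (\<forall>u. (\<forall>k<n. (\<Sum>l<n. X k l * u l) = 0) \<longrightarrow> (\<forall>l<n. u l = 0))"
  using assms
proof (induction J rule: finite_induct)
  case empty
  have "(\<Sum>l<n. (if k = l then 1 else 0) * u l) = u k" if "k < n" for k and u :: "nat \<Rightarrow> int"
    using that by (simp add: if_distrib[of "\<lambda>z. z * _"] sum.delta' cong: if_cong)
  then show ?case
    by (intro exI[of _ "\<lambda>k l. if k = l then 1 else 0"] exI[of _ 1]) auto
next
  case (insert i J)
  have "\<forall>j\<in>J. u j = 0" if u: "\<forall>k<n. (\<Sum>j\<in>J. u j * v j k) = 0" for u
  proof -
    have "(\<Sum>j\<in>J. (if j = i then 0 else u j) * v j k) = (\<Sum>j\<in>J. u j * v j k)" for k
      using insert.hyps by (intro sum.cong) auto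
    then have "\<forall>k<n. (\<Sum>j\<in>insert i J. (if j = i then 0 else u j) * v j k) = 0"
      using u insert.hyps by simp
    from insert.prems[OF this] show ?thesis using insert.hyps(2) by (metis insertI2)
  qed
  from insert.IH[OF this] obtain X D \<pi> where D: "D \<noteq> (0::int)" and \<pi>: "inj_on \<pi> J" "\<pi> ` J \<subseteq> {..<n}"
    and dual: "\<forall>j\<in>J. \<forall>k<n. (\<Sum>l<n. X k l * v j l) = (if k = \<pi> j then D else 0)"
    and inj: "\<forall>u. (\<forall>k<n. (\<Sum>l<n. X k l * u l) = 0) \<longrightarrow> (\<forall>l<n. u l = 0)"
    by blast
  define L where "L k u = (\<Sum>l<n. X k l * u l)" for k u
  \<comment> \<open>Some row without a pivot sees \<open>v i\<close>. Otherwise all rows kill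
    \<open>w\<close>, so \<open>w\<close> vanishes, and this is a relation in which
    \<open>v i\<close> has the nonzero coefficient \<open>D\<close>.\<close>
  have "\<exists>k<n. k \<notin> \<pi> ` J \<and> L k (v i) \<noteq> 0"
  proof (rule ccontr)
    assume contra: "\<not> ?thesis"
    define w where "w l = D * v i l - (\<Sum>j\<in>J. L (\<pi> j) (v i) * v j l)" for l
    have "L k w = 0" if k: "k < n" for k
    proof -
      have "(\<Sum>l<n. X k l * (\<Sum>j\<in>J. L (\<pi> j) (v i) * v j l))
          = (\<Sum>j\<in>J. L (\<pi> j) (v i) * (\<Sum>l<n. X k l * v j l))"
        unfolding sum_distrib_left by (subst sum.swap) (simp add: mult.left_commute)
      moreover have "(\<Sum>l<n. X k l * (D * v i l)) = D * (\<Sum>l<n. X k l * v i l)"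
        by (simp add: sum_distrib_left mult.left_commute)
      ultimately have "L k w = D * L k (v i) - (\<Sum>j\<in>J. L (\<pi> j) (v i) * L k (v j))"
        by (simp add: L_def[of k] w_def right_diff_distrib sum_subtractf)
      also have "(\<Sum>j\<in>J. L (\<pi> j) (v i) * L k (v j)) = (\<Sum>j\<in>J. if k = \<pi> j then L (\<pi> j) (v i) * D else 0)"
        using dual k by (intro sum.cong) (auto simp: L_def)
      also have "\<dots> = D * L k (v i)"
      proof (cases "k \<in> \<pi> ` J")
        case True
        then obtain j0 where j0: "j0 \<in> J" "k = \<pi> j0" by blast
        then have "(\<Sum>j\<in>J. if k = \<pi> j then L (\<pi> j) (v i) * D else 0)
            = (\<Sum>j\<in>J. if j = j0 then L (\<pi> j) (v i) * D else 0)"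
          using \<pi>(1) by (intro sum.cong) (auto dest: inj_onD)
        then show ?thesis using j0 insert.hyps by simp
      next
        case False
        then have "(\<Sum>j\<in>J. if k = \<pi> j then L (\<pi> j) (v i) * D else 0) = 0"
          by (intro sum.neutral) auto
        then show ?thesis using False contra k by auto
      qed
      finally show ?thesis by simp
    qed
    then have w0: "\<forall>l<n. w l = 0" using inj unfolding L_def by blast
    let ?u = "\<lambda>j. if j = i then D else - L (\<pi> j) (v i)"
    have "(\<Sum>j\<in>J. ?u j * v j k) = - (\<Sum>j\<in>J. L (\<pi> j) (v i) * v j k)" for k
      unfolding sum_negf[symmetric] using insert.hyps by (intro sum.cong) auto
    then have "\<forall>k<n. (\<Sum>j\<in>insert i J. ?u j * v j k) = 0"
      using w0 insert.hyps by (simp add: w_def)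
    from insert.prems[OF this] show False using D by simp
  qed
  then obtain k0 where k0: "k0 < n" "k0 \<notin> \<pi> ` J" "L k0 (v i) \<noteq> 0" by blast
  let ?d = "L k0 (v i)"
  \<comment> \<open>Row \<open>k0\<close> becomes the pivot row of \<open>i\<close>. It vanishes on
    the old vectors, so their pivots become \<open>D * ?d\<close>, and scaling row \<open>k0\<close>
    by \<open>D\<close> gives the same value at \<open>v i\<close>.\<close>
  define X' where "X' k l = (if k = k0 then D * X k0 l else ?d * X k l - L k (v i) * X k0 l)" for k l
  have L': "(\<Sum>l<n. X' k l * u l) = (if k = k0 then D * L k0 u else ?d * L k u - L k (v i) * L k0 u)"
    for k u
    unfolding X'_def L_def[of _ u]
    by (simp add: sum_distrib_left left_diff_distrib sum_subtractf mult.assoc)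
  have \<pi>': "inj_on (\<pi>(i := k0)) (insert i J)" "(\<pi>(i := k0)) ` insert i J \<subseteq> {..<n}"
    using \<pi> k0 insert.hyps by (auto simp: inj_on_def)
  have Ldual: "L k (v j) = (if k = \<pi> j then D else 0)" if "j \<in> J" "k < n" for j k
    using dual that by (simp add: L_def)
  have dual': "\<forall>j\<in>insert i J. \<forall>k<n.
      (\<Sum>l<n. X' k l * v j l) = (if k = (\<pi>(i := k0)) j then D * ?d else 0)"
  proof (intro ballI allI impI)
    fix j k assume j: "j \<in> insert i J" and k: "k < n"
    show "(\<Sum>l<n. X' k l * v j l) = (if k = (\<pi>(i := k0)) j then D * ?d else 0)"
    proof (cases "j = i")
      case True
      then show ?thesis by (simp add: L')
    next
      case False
      then have "j \<in> J" "k0 \<noteq> \<pi> j" using j k0 by auto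
      then show ?thesis using False k k0 Ldual by (auto simp: L')
    qed
  qed
  \<comment> \<open>Once row \<open>k0\<close> vanishes on \<open>u\<close>, every other new row is
    \<open>?d\<close> times the old one there.\<close>
  have inj': "\<forall>u. (\<forall>k<n. (\<Sum>l<n. X' k l * u l) = 0) \<longrightarrow> (\<forall>l<n. u l = 0)"
  proof (intro allI impI)
    fix u :: "nat \<Rightarrow> int" and l assume u: "\<forall>k<n. (\<Sum>l<n. X' k l * u l) = 0" and l: "l < n"
    have 0: "L k0 u = 0" using u[rule_format, OF k0(1)] D by (simp add: L')
    have "L k u = 0" if "k < n" for k
      using u[rule_format, OF that] 0 k0(3) by (cases "k = k0") (simp_all add: L')
    then show "u l = 0" using inj l unfolding L_def by blast
  qed
  have D': "D * ?d \<noteq> 0" using D k0(3) by simp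
  from D' \<pi>' dual' inj' show ?case by (intro exI conjI)
qed

text \<open>An integer relation is read as a real linear combination over the set of vectors;
  injectivity of the family carries coefficients from indices to vectors.\<close>

lemma lin_indep_family_int:
  assumes li: "lin_indep_family n J (\<lambda>j. real_vec_of n (v j))" and finJ: "finite J"
    and u: "\<forall>k<n. (\<Sum>j\<in>J. u j * v j k) = 0"
  shows "\<forall>j\<in>J. u j = 0"
proof -
  interpret vec_space "TYPE(real)" n .
  let ?V = "\<lambda>j. real_vec_of n (v j)"
  have inj: "inj_on ?V J" and car: "?V ` J \<subseteq> carrier_vec n" and indep: "\<not> lin_dep (?V ` J)"
    using li by (simp_all add: lin_indep_family_def)
  define c where "c x = real_of_int (u (the_inv_into J ?V x))" for x
  have c: "c (?V j) = real_of_int (u j)" if "j \<in> J" for j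
    using the_inv_into_f_f[OF inj that] by (simp add: c_def)
  have "lincomb c (?V ` J) = 0\<^sub>v n"
  proof (rule eq_vecI)
    fix k assume "k < dim_vec (0\<^sub>v n)"
    then have k: "k < n" by simp
    have "lincomb c (?V ` J) $ k = (\<Sum>x\<in>?V ` J. c x * x $ k)"
      using lincomb_index[OF k car] by simp
    also have "\<dots> = (\<Sum>j\<in>J. real_of_int (u j * v j k))"
      using inj c k by (simp add: sum.reindex real_vec_of_def)
    also have "\<dots> = real_of_int (\<Sum>j\<in>J. u j * v j k)" by simp
    also have "\<dots> = 0" using u k by (simp only: of_int_0)
    finally show "lincomb c (?V ` J) $ k = 0\<^sub>v n $ k" using k by simp
  qed (use lincomb_dim[OF _ car] finJ in simp)
  show ?thesis
  proof (rule ccontr)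
    assume "\<not> ?thesis"
    then obtain j where "j \<in> J" "u j \<noteq> 0" by blast
    then have "lin_dep (?V ` J)"
      unfolding lin_dep_def using finJ c \<open>lincomb c (?V ` J) = 0\<^sub>v n\<close>
      by (intro exI[of _ "?V ` J"] exI[of _ c] exI[of _ "?V j"]) (auto simp: class_field_def)
    with indep show False by blast
  qed
qed

text \<open>The functionals are dual to the independent subfamily. Every other member is plus or
  minus one of it, so it has the same single nonzero coordinate up to sign.\<close>

lemma nearly_lin_indep_dual:
  assumes nli: "nearly_lin_indep n I (\<lambda>i. real_vec_of n (v i))" and fin: "finite I"
  shows "\<exists>X D. D \<noteq> (0::int) \<and>
    (\<forall>i\<in>I. \<exists>j<n. \<exists>s\<in>{1, -1}. \<forall>k<n. (\<Sum>l<n. X k l * v i l) = (if k = j then s * D else 0)) \<and>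
    (\<forall>u. (\<forall>k<n. (\<Sum>l<n. X k l * u l) = 0) \<longrightarrow> (\<forall>l<n. u l = 0))"
proof -
  obtain J where J: "J \<subseteq> I" "lin_indep_family n J (\<lambda>j. real_vec_of n (v j))"
    "\<forall>i\<in>I. \<exists>j\<in>J. real_vec_of n (v i) = real_vec_of n (v j) \<or> real_vec_of n (v i) = - real_vec_of n (v j)"
    using nli unfolding nearly_lin_indep_def by blast
  have finJ: "finite J" using J(1) fin finite_subset by blast
  from dual_functionals[OF finJ lin_indep_family_int[OF J(2) finJ]]
  obtain X D \<pi> where D: "D \<noteq> (0::int)" and \<pi>: "\<pi> ` J \<subseteq> {..<n}"
    and dual: "\<forall>j\<in>J. \<forall>k<n. (\<Sum>l<n. X k l * v j l) = (if k = \<pi> j then D else 0)"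
    and inj: "\<forall>u. (\<forall>k<n. (\<Sum>l<n. X k l * u l) = 0) \<longrightarrow> (\<forall>l<n. u l = 0)"
    by blast
  have "\<forall>i\<in>I. \<exists>j<n. \<exists>s\<in>{1, -1}. \<forall>k<n. (\<Sum>l<n. X k l * v i l) = (if k = j then s * D else 0)"
  proof
    fix i assume "i \<in> I"
    then obtain j where j: "j \<in> J"
      "real_vec_of n (v i) = real_vec_of n (v j) \<or> real_vec_of n (v i) = - real_vec_of n (v j)"
      using J(3) by blast
    have "\<exists>s\<in>{1, -1}. \<forall>l<n. v i l = s * v j l"
      using j(2)
    proof
      assume "real_vec_of n (v i) = real_vec_of n (v j)"
      then have "v i l = v j l" if "l < n" for l
        using that by (auto simp: real_vec_of_def vec_eq_iff)
      then show ?thesis by auto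
    next
      assume eq: "real_vec_of n (v i) = - real_vec_of n (v j)"
      have "v i l = - v j l" if "l < n" for l
      proof -
        have "real_of_int (v i l) = - real_of_int (v j l)"
          using arg_cong[OF eq, of "\<lambda>w. w $ l"] that by (simp add: real_vec_of_def)
        then show ?thesis by linarith
      qed
      then show ?thesis by auto
    qed
    then obtain s where s: "s \<in> {1, -1}" "\<forall>l<n. v i l = s * v j l" by blast
    have "(\<Sum>l<n. X k l * v i l) = s * (\<Sum>l<n. X k l * v j l)" for k
      unfolding sum_distrib_left using s(2) by (intro sum.cong) auto
    then show "\<exists>j<n. \<exists>s\<in>{1, -1}. \<forall>k<n. (\<Sum>l<n. X k l * v i l) = (if k = j then s * D else 0)"
      using dual j(1) \<pi> s(1) by (intro exI[of _ "\<pi> j"] conjI bexI[of _ s]) auto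
  qed
  with D inj show ?thesis by (intro exI conjI)
qed

section \<open>Finite quotients of finite-by-(free abelian) groups\<close>

lemma (in group) additive_int_pow:
  assumes add: "\<And>x y. \<lbrakk>x \<in> carrier G; y \<in> carrier G\<rbrakk> \<Longrightarrow> f (x \<otimes> y) = f x + (f y :: int)"
    and x: "x \<in> carrier G"
  shows "f (x [^] (k::int)) = k * f x"
proof -
  have "f \<in> hom G integer_group" by (rule homI) (simp_all add: add)
  then interpret f: group_hom G integer_group f
    by (simp add: group_hom_def group_hom_axioms_def is_group)
  show ?thesis using f.hom_int_pow[OF x, of k] by simp
qed

lemma (in group) pow_card_subgroup:
  assumes "subgroup H G" "x \<in> H"
  shows "x [^] card H = \<one>"
proof -
  interpret H: group "G\<lparr>carrier := H\<rparr>" by (rule subgroup.subgroup_is_group[OF assms(1) is_group])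
  have "x [^]\<^bsub>G\<lparr>carrier := H\<rparr>\<^esub> card H = \<one>"
    using H.pow_order_eq_1[of x] assms(2) by (simp add: Coset.order_def)
  then show ?thesis by (simp add: nat_pow_consistent[symmetric])
qed

text \<open>\<open>\<xi> k\<close> is the \<open>k\<close>-th coordinate of the quotient map, so the
  extension is described on \<open>A\<close> without the factor group.\<close>

locale lattice_by_finite = group A for A :: "('a, 'c) monoid_scheme" (structure) +
  fixes H :: "'a set" and n :: nat and \<xi> :: "nat \<Rightarrow> 'a \<Rightarrow> int"
  assumes fin_H: "finite H"
    and \<xi>_mult: "\<lbrakk>k < n; x \<in> carrier A; y \<in> carrier A\<rbrakk> \<Longrightarrow> \<xi> k (x \<otimes> y) = \<xi> k x + \<xi> k y"
    and \<xi>_kernel: "H = {x \<in> carrier A. \<forall>k<n. \<xi> k x = 0}"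
    and \<xi>_surj: "\<exists>x\<in>carrier A. \<forall>k<n. \<xi> k x = u k"
begin

lemma mem_H: "x \<in> H \<longleftrightarrow> x \<in> carrier A \<and> (\<forall>k<n. \<xi> k x = 0)"
  using \<xi>_kernel by blast

lemma \<xi>_one: "k < n \<Longrightarrow> \<xi> k \<one> = 0"
  using \<xi>_mult[of k \<one> \<one>] by simp

lemma \<xi>_inv: "k < n \<Longrightarrow> x \<in> carrier A \<Longrightarrow> \<xi> k (inv x) = - \<xi> k x"
  using \<xi>_mult[of k x "inv x"] \<xi>_one by simp

lemma \<xi>_int_pow: "k < n \<Longrightarrow> x \<in> carrier A \<Longrightarrow> \<xi> k (x [^] (i::int)) = i * \<xi> k x"
  using additive_int_pow[of "\<xi> k" x i] \<xi>_mult by blast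

lemma \<xi>_nat_pow: "k < n \<Longrightarrow> x \<in> carrier A \<Longrightarrow> \<xi> k (x [^] (i::nat)) = int i * \<xi> k x"
  using \<xi>_int_pow[of k x "int i"] by (simp add: int_pow_int)

lemma subgroup_H: "subgroup H A"
proof (rule subgroupI)
  have "\<one> \<in> H" by (simp add: mem_H \<xi>_one)
  then show "H \<noteq> {}" by blast
qed (auto simp: mem_H \<xi>_mult \<xi>_inv)

lemma card_H_pos: "card H > 0"
  using subgroup.one_closed[OF subgroup_H] fin_H by (auto simp: card_gt_0_iff)

text \<open>The conjugates of \<open>\<beta>\<close> by powers of \<open>\<alpha>\<close> lie in the finite set \<open>H \<beta>\<close>.\<close>

lemma some_pow_commutes:
  assumes \<alpha>: "\<alpha> \<in> carrier A" and \<beta>: "\<beta> \<in> carrier A"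
  obtains d where "d \<in> {1..card H}" "\<beta> \<otimes> \<alpha> [^] d = \<alpha> [^] d \<otimes> \<beta>"
proof -
  \<comment> \<open>These commutators lie in \<open>H\<close> because the quotient is abelian. Among
    \<open>card H + 1\<close> exponents two give the same value.\<close>
  define f where "f i = \<alpha> [^] i \<otimes> \<beta> \<otimes> inv (\<alpha> [^] i) \<otimes> inv \<beta>" for i :: nat
  have "f ` {0..card H} \<subseteq> H"
    using \<alpha> \<beta> by (auto simp: f_def mem_H \<xi>_mult \<xi>_inv)
  then have "card (f ` {0..card H}) \<le> card H" by (rule card_mono[OF fin_H])
  then have "\<not> inj_on f {0..card H}"
    by (intro pigeonhole) simp
  then obtain i j where ij: "i < j" "j \<le> card H" "f i = f j"
    unfolding inj_on_def by (metis atLeastAtMost_iff linorder_neqE_nat)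
  define d where "d = j - i"
  have pow: "\<alpha> [^] j = \<alpha> [^] i \<otimes> \<alpha> [^] d"
    using ij \<alpha> by (simp add: d_def nat_pow_mult)
  let ?p = "\<alpha> [^] i" and ?q = "\<alpha> [^] d"
  have c: "?p \<in> carrier A" "?q \<in> carrier A" using \<alpha> by auto
  have "?p \<otimes> \<beta> \<otimes> inv ?p = f i \<otimes> \<beta>"
    using c \<beta> by (simp add: f_def m_assoc)
  also have "\<dots> = f j \<otimes> \<beta>" using ij(3) by simp
  also have "\<dots> = ?p \<otimes> ?q \<otimes> \<beta> \<otimes> inv (?p \<otimes> ?q)"
    unfolding f_def pow using c \<beta> by (simp add: m_assoc)
  also have "\<dots> = ?p \<otimes> (?q \<otimes> \<beta> \<otimes> inv ?q) \<otimes> inv ?p"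
    using c \<beta> by (simp add: m_assoc inv_mult_group)
  finally have "\<beta> = ?q \<otimes> \<beta> \<otimes> inv ?q"
    using c \<beta> by simp
  then have "\<beta> \<otimes> ?q = ?q \<otimes> \<beta> \<otimes> inv ?q \<otimes> ?q" by simp
  also have "\<dots> = ?q \<otimes> \<beta>" using c \<beta> by (simp add: m_assoc)
  finally show ?thesis using ij by (intro that[of d]) (auto simp: d_def)
qed

text \<open>The factorial is a common multiple of all exponents that
  \<open>some_pow_commutes\<close> can return, so every \<open>cexp\<close>-th power is
  central.\<close>

definition cexp :: nat where "cexp = fact (card H)"

lemma cexp_pow_commutes:
  assumes \<alpha>: "\<alpha> \<in> carrier A" and \<beta>: "\<beta> \<in> carrier A"
  shows "\<beta> \<otimes> \<alpha> [^] cexp = \<alpha> [^] cexp \<otimes> \<beta>"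
proof -
  obtain d where d: "d \<in> {1..card H}" "\<beta> \<otimes> \<alpha> [^] d = \<alpha> [^] d \<otimes> \<beta>"
    using some_pow_commutes[OF assms] .
  have "d dvd cexp" unfolding cexp_def using d(1) by (intro dvd_fact) auto
  then obtain q where "cexp = d * q" by (elim dvdE)
  then have "\<alpha> [^] cexp = (\<alpha> [^] d) [^] int q"
    using \<alpha> by (simp add: nat_pow_pow int_pow_int)
  then show ?thesis
    using intertwine_int_pow[OF \<beta> _ _ d(2), of "int q"] \<alpha> by simp
qed

text \<open>The extra factor kills \<open>H\<close> and turns the power map into a
  homomorphism.\<close>

definition zexp :: nat where "zexp = cexp * card H"

lemma zexp_pos: "zexp > 0"
  by (simp add: zexp_def cexp_def card_H_pos)

lemma zexp_pow_commutes:
  assumes "\<alpha> \<in> carrier A" "\<beta> \<in> carrier A"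
  shows "\<beta> \<otimes> \<alpha> [^] zexp = \<alpha> [^] zexp \<otimes> \<beta>"
  using cexp_pow_commutes[of "\<alpha> [^] card H" \<beta>] assms
  by (simp add: zexp_def nat_pow_pow mult.commute)

lemma zexp_pow_H:
  assumes "x \<in> H"
  shows "x [^] zexp = \<one>"
proof -
  have "x [^] (card H * cexp) = (x [^] card H) [^] cexp"
    using subgroup.mem_carrier[OF subgroup_H assms] by (simp only: nat_pow_pow)
  then show ?thesis
    using pow_card_subgroup[OF subgroup_H assms] by (simp add: zexp_def mult.commute)
qed

text \<open>The \<open>cexp\<close>-th power of a product differs from the product of the powers by
  an element of \<open>H\<close>. It commutes with those central powers, so raising to the power
  \<open>card H\<close> removes it.\<close>

lemma zexp_pow_mult:
  assumes "\<gamma> \<in> carrier A" "\<delta> \<in> carrier A"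
  shows "(\<gamma> \<otimes> \<delta>) [^] zexp = \<gamma> [^] zexp \<otimes> \<delta> [^] zexp"
proof -
  let ?E = cexp and ?e = "card H"
  define p where "p = \<gamma> [^] ?E \<otimes> \<delta> [^] ?E"
  define h where "h = inv p \<otimes> (\<gamma> \<otimes> \<delta>) [^] ?E"
  have p: "p \<in> carrier A" using assms by (simp add: p_def)
  have h: "h \<in> H"
    using assms p
    by (simp add: h_def mem_H) (simp add: p_def \<xi>_mult \<xi>_inv \<xi>_nat_pow algebra_simps)
  have hc: "h \<in> carrier A" using h subgroup.mem_carrier[OF subgroup_H] by blast
  have "p \<otimes> h = \<gamma> [^] ?E \<otimes> (h \<otimes> \<delta> [^] ?E)"
    using hc assms cexp_pow_commutes[OF assms(2) hc] by (simp add: p_def m_assoc)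
  also have "\<dots> = \<gamma> [^] ?E \<otimes> h \<otimes> \<delta> [^] ?E"
    using hc assms by (simp add: m_assoc)
  also have "\<dots> = h \<otimes> p"
    using hc assms by (simp add: p_def m_assoc flip: cexp_pow_commutes[OF assms(1) hc])
  finally have ph: "p \<otimes> h = h \<otimes> p" .
  have "(\<gamma> \<otimes> \<delta>) [^] ?E = p \<otimes> h"
    using p assms by (simp add: h_def m_assoc[symmetric])
  then have "(\<gamma> \<otimes> \<delta>) [^] zexp = (p \<otimes> h) [^] ?e"
    using assms nat_pow_pow[of "\<gamma> \<otimes> \<delta>" ?E ?e] by (simp add: zexp_def)
  also have "\<dots> = p [^] ?e \<otimes> h [^] ?e"
    by (rule pow_mult_distrib[OF ph p hc])
  also have "h [^] ?e = \<one>" using pow_card_subgroup[OF subgroup_H h] .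
  also have "p [^] ?e = (\<gamma> [^] ?E) [^] ?e \<otimes> (\<delta> [^] ?E) [^] ?e"
    unfolding p_def using assms by (intro pow_mult_distrib cexp_pow_commutes nat_pow_closed)
  finally show ?thesis using assms by (simp add: zexp_def nat_pow_pow)
qed

text \<open>The part of level \<open>q\<close> in the image of the \<open>zexp\<close>-th power map:
  it is central and, for functionals as in the next locale, meets \<open>H\<close>
  trivially.\<close>

definition Z :: "(nat \<Rightarrow> 'a \<Rightarrow> int) \<Rightarrow> int \<Rightarrow> 'a set" where
  "Z x q = {\<gamma> [^] zexp | \<gamma>. \<gamma> \<in> carrier A \<and> (\<forall>k<n. q dvd x k (\<gamma> [^] zexp))}"

end

text \<open>The functionals are kept abstract; that they vanish on \<open>H\<close> follows from
  torsion in \<open>x_H\<close>.\<close>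

locale dual_functionals = lattice_by_finite +
  fixes x :: "nat \<Rightarrow> 'a \<Rightarrow> int"
  assumes x_mult: "\<lbrakk>k < n; \<alpha> \<in> carrier A; \<beta> \<in> carrier A\<rbrakk> \<Longrightarrow> x k (\<alpha> \<otimes> \<beta>) = x k \<alpha> + x k \<beta>"
    and x_kernel: "\<alpha> \<in> carrier A \<Longrightarrow> \<forall>k<n. x k \<alpha> = 0 \<Longrightarrow> \<alpha> \<in> H"
begin

lemma x_one: "k < n \<Longrightarrow> x k \<one> = 0"
  using x_mult[of k \<one> \<one>] by simp

lemma x_inv: "k < n \<Longrightarrow> \<alpha> \<in> carrier A \<Longrightarrow> x k (inv \<alpha>) = - x k \<alpha>"
  using x_mult[of k \<alpha> "inv \<alpha>"] x_one by simp

lemma x_int_pow: "k < n \<Longrightarrow> \<alpha> \<in> carrier A \<Longrightarrow> x k (\<alpha> [^] (i::int)) = i * x k \<alpha>"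
  using additive_int_pow[of "x k" \<alpha> i] x_mult by blast

lemma x_nat_pow: "k < n \<Longrightarrow> \<alpha> \<in> carrier A \<Longrightarrow> x k (\<alpha> [^] (i::nat)) = int i * x k \<alpha>"
  using x_int_pow[of k \<alpha> "int i"] by (simp add: int_pow_int)

section \<open>The central subgroups \<open>Z x q\<close> and the quotients by them\<close>

lemma Z_subset: "Z x q \<subseteq> carrier A"
  by (auto simp: Z_def)

text \<open>Closure under products is multiplicativity of the \<open>zexp\<close>-th power map, and
  normality is centrality.\<close>

lemma Z_normal: "Z x q \<lhd> A"
proof -
  have "subgroup (Z x q) A"
  proof (rule subgroupI[OF Z_subset])
    have "\<one> \<in> Z x q"
      unfolding Z_def by (intro CollectI exI[of _ \<one>]) (simp add: x_one)
    then show "Z x q \<noteq> {}" by blast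
    fix z assume z: "z \<in> Z x q"
    then obtain \<gamma> where \<gamma>: "\<gamma> \<in> carrier A" "z = \<gamma> [^] zexp" "\<forall>k<n. q dvd x k z"
      by (auto simp: Z_def)
    have "inv z = inv \<gamma> [^] zexp" using \<gamma> by (simp add: nat_pow_inv)
    moreover have "\<forall>k<n. q dvd x k (inv z)" using \<gamma> by (simp add: x_inv)
    ultimately show "inv z \<in> Z x q" using \<gamma> by (auto simp: Z_def)
    fix w assume "w \<in> Z x q"
    then obtain \<delta> where \<delta>: "\<delta> \<in> carrier A" "w = \<delta> [^] zexp" "\<forall>k<n. q dvd x k w"
      by (auto simp: Z_def)
    have "z \<otimes> w = (\<gamma> \<otimes> \<delta>) [^] zexp" using \<gamma> \<delta> by (simp add: zexp_pow_mult)
    moreover have "\<forall>k<n. q dvd x k (z \<otimes> w)" using \<gamma> \<delta> by (simp add: x_mult)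
    ultimately show "z \<otimes> w \<in> Z x q" 
      unfolding Z_def using \<gamma>(1) \<delta>(1) by (intro CollectI exI[of _ "\<gamma> \<otimes> \<delta>"]) simp
  qed
  moreover have "\<beta> \<otimes> z \<otimes> inv \<beta> \<in> Z x q" if "\<beta> \<in> carrier A" "z \<in> Z x q" for \<beta> z
  proof -
    have "\<beta> \<otimes> z = z \<otimes> \<beta>" using that zexp_pow_commutes by (auto simp: Z_def)
    then have "\<beta> \<otimes> z \<otimes> inv \<beta> = z"
      using that(1) subsetD[OF Z_subset that(2)] by (simp add: m_assoc)
    then show ?thesis using that by simp
  qed
  ultimately show ?thesis by (simp add: normal_inv_iff)
qed

text \<open>The functionals already vanish on \<open>\<gamma>\<close>, since the integers have no
  torsion; so \<open>\<gamma>\<close> lies in \<open>H\<close>, which \<open>zexp\<close>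
  kills.\<close>

lemma pow_in_H_eq_one:
  assumes "\<gamma> \<in> carrier A" "\<forall>k<n. x k (\<gamma> [^] zexp) = 0"
  shows "\<gamma> [^] zexp = \<one>"
proof -
  have "\<forall>k<n. x k \<gamma> = 0" using assms zexp_pos by (simp add: x_nat_pow)
  then show ?thesis using assms(1) x_kernel zexp_pow_H by blast
qed

lemma x_H:
  assumes "\<alpha> \<in> H" "k < n"
  shows "x k \<alpha> = 0"
proof -
  have "\<alpha> \<in> carrier A" using assms(1) mem_H by simp
  then have "int zexp * x k \<alpha> = 0"
    using x_nat_pow[of k \<alpha> zexp] zexp_pow_H[OF assms(1)] assms(2) x_one by simp
  then show ?thesis using zexp_pos by simp
qed

lemma Z_inter_H: "Z x q \<inter> H \<subseteq> {\<one>}"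
  using x_H pow_in_H_eq_one by (auto simp: Z_def)

text \<open>Representatives are products of an element of \<open>H\<close> and one element for each
  vector of residues of the coordinates modulo \<open>r\<close>.\<close>

lemma Z_finite_index:
  assumes q: "q \<noteq> 0"
  shows "finite (rcosets (Z x q))"
proof -
  define Q where "Q = nat \<bar>q\<bar>"
  have Q: "Q > 0" "q dvd int Q" using q by (simp_all add: Q_def)
  \<comment> \<open>The factor \<open>zexp\<close> makes an \<open>r\<close>-th power a
    \<open>zexp\<close>-th power, and \<open>Q\<close> makes its functionals divisible by
    \<open>q\<close>.\<close>
  define r where "r = Q * zexp"
  have r: "r > 0" using Q zexp_pos by (simp add: r_def)
  define \<kappa> where "\<kappa> \<alpha> = (\<lambda>k\<in>{..<n}. \<xi> k \<alpha> mod int r)" for \<alpha>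
  have "\<kappa> ` carrier A \<subseteq> PiE {..<n} (\<lambda>_. {0..<int r})"
    using r by (simp add: \<kappa>_def image_subset_iff restrict_PiE_iff)
  then have fin: "finite (\<kappa> ` carrier A)"
    by (rule finite_subset) (intro finite_PiE, auto)
  define rep where "rep c = (SOME y. y \<in> carrier A \<and> \<kappa> y = c)" for c
  have rep: "rep (\<kappa> \<alpha>) \<in> carrier A \<and> \<kappa> (rep (\<kappa> \<alpha>)) = \<kappa> \<alpha>" if "\<alpha> \<in> carrier A" for \<alpha>
    unfolding rep_def using that by (intro someI[of "\<lambda>y. y \<in> carrier A \<and> \<kappa> y = \<kappa> \<alpha>"]) auto
  have Hc: "H \<subseteq> carrier A" by (auto simp: mem_H)
  let ?T = "(\<lambda>(h, c). h \<otimes> rep c) ` (H \<times> \<kappa> ` carrier A)"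
  show ?thesis
  proof (rule finite_rcosetsI[of _ ?T])
    show "subgroup (Z x q) A" using Z_normal by (rule normal_imp_subgroup)
    show "finite ?T" using fin fin_H by simp
    show "?T \<subseteq> carrier A" using rep Hc by auto
    fix \<alpha> assume \<alpha>: "\<alpha> \<in> carrier A"
    let ?\<beta> = "rep (\<kappa> \<alpha>)"
    have \<beta>: "?\<beta> \<in> carrier A" using rep[OF \<alpha>] by simp
    have "int r dvd \<xi> k (\<alpha> \<otimes> inv ?\<beta>)" if k: "k < n" for k
    proof -
      have "\<kappa> ?\<beta> k = \<kappa> \<alpha> k" using rep[OF \<alpha>] by simp
      then have "\<xi> k \<alpha> mod int r = \<xi> k ?\<beta> mod int r" using k by (simp add: \<kappa>_def)
      then have "int r dvd \<xi> k \<alpha> - \<xi> k ?\<beta>" by (metis mod_eq_dvd_iff)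
      then show ?thesis using k \<alpha> \<beta> by (simp add: \<xi>_mult \<xi>_inv)
    qed
    then have u: "\<forall>k<n. \<xi> k (\<alpha> \<otimes> inv ?\<beta>) = int r * (\<xi> k (\<alpha> \<otimes> inv ?\<beta>) div int r)" by simp
    \<comment> \<open>By surjectivity of the coordinates, some \<open>r\<close>-th power agrees with
      \<open>\<alpha> \<otimes> inv ?\<beta>\<close> modulo \<open>H\<close>.\<close>
    obtain \<gamma> where \<gamma>: "\<gamma> \<in> carrier A" "\<forall>k<n. \<xi> k \<gamma> = \<xi> k (\<alpha> \<otimes> inv ?\<beta>) div int r"
      using \<xi>_surj[of "\<lambda>k. \<xi> k (\<alpha> \<otimes> inv ?\<beta>) div int r"] by blast
    define z where "z = \<gamma> [^] r"
    have zc: "z \<in> carrier A" using \<gamma> by (simp add: z_def)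
    have zZ: "z \<in> Z x q"
    proof -
      have "z = (\<gamma> [^] Q) [^] zexp" using \<gamma> by (simp add: z_def r_def nat_pow_pow)
      moreover have "\<forall>k<n. q dvd x k z" using \<gamma> Q(2) by (simp add: z_def x_nat_pow r_def)
      ultimately show ?thesis
        unfolding Z_def using \<gamma>(1) by (intro CollectI exI[of _ "\<gamma> [^] Q"]) auto
    qed
    define h where "h = inv z \<otimes> (\<alpha> \<otimes> inv ?\<beta>)"
    have "\<forall>k<n. \<xi> k z = \<xi> k (\<alpha> \<otimes> inv ?\<beta>)"
      using \<gamma> u by (simp add: z_def \<xi>_nat_pow)
    then have hH: "h \<in> H"
      using \<alpha> \<beta> zc by (simp add: h_def mem_H \<xi>_mult \<xi>_inv)
    have "z \<otimes> h = \<alpha> \<otimes> inv ?\<beta>"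
      using zc \<alpha> \<beta> by (simp add: h_def m_assoc[symmetric])
    then have "\<alpha> \<otimes> inv (h \<otimes> ?\<beta>) = z"
      using zc \<alpha> \<beta> hH Hc by (simp add: inv_mult_group m_assoc[symmetric] inv_solve_right' subset_iff)
    then have "\<alpha> \<otimes> inv (h \<otimes> ?\<beta>) \<in> Z x q" using zZ by (simp only:)
    moreover have "h \<otimes> ?\<beta> \<in> ?T" using hH \<alpha> by force
    ultimately show "\<exists>y\<in>?T. \<alpha> \<otimes> inv y \<in> Z x q" by (rule bexI)
  qed
qed

text \<open>The common \<open>D\<close> is what gives all axial elements the same order in the
  quotients below.\<close>

definition axial :: "int \<Rightarrow> 'a \<Rightarrow> bool" where
  "axial D c \<longleftrightarrow> c \<in> carrier A \<and>
     (\<exists>j<n. \<exists>s\<in>{1, -1}. \<forall>k<n. x k c = (if k = j then s * D else 0))"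

text \<open>The subgroup is \<open>Z x q\<close> with \<open>q\<close> larger than all functionals
  on \<open>B\<close>. If it contains \<open>c [^] k \<otimes> \<beta>\<close>, then the coordinates
  off the axis of \<open>c\<close> vanish, and the one on the axis is that of a power of
  \<open>c\<close>.\<close>

lemma separating_quotient:
  assumes D: "D \<noteq> 0" and B: "finite B" "B \<subseteq> carrier A"
  shows "\<exists>M N. M \<lhd> A \<and> finite (rcosets M) \<and> M \<inter> H \<subseteq> {\<one>} \<and> N > (0::nat) \<and>
    (\<forall>c. axial D c \<longrightarrow> (\<forall>k::int. c [^] k \<in> M \<longleftrightarrow> int N dvd k)) \<and>
    (\<forall>c. axial D c \<longrightarrow> (\<forall>\<beta>\<in>B. (\<forall>k::int. \<beta> \<noteq> c [^] k) \<longrightarrow> (\<forall>k::int. c [^] k \<otimes> \<beta> \<notin> M)))"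
proof -
  \<comment> \<open>\<open>Suc b\<close> makes \<open>N\<close> exceed every functional on
    \<open>B\<close> in absolute value; the factor \<open>zexp\<close> makes \<open>N\<close>-th
    powers \<open>zexp\<close>-th powers.\<close>
  define b where "b = (\<Sum>\<beta>\<in>B. \<Sum>k<n. nat \<bar>x k \<beta>\<bar>)"
  define N where "N = zexp * Suc b"
  have N: "N > 0" using zexp_pos by (simp add: N_def)
  define q where "q = int N * D"
  have q: "q \<noteq> 0" using N D by (simp add: q_def)
  have bound: "\<bar>x k \<beta>\<bar> < \<bar>q\<bar>" if "\<beta> \<in> B" "k < n" for k \<beta>
  proof -
    have "nat \<bar>x k \<beta>\<bar> \<le> (\<Sum>k<n. nat \<bar>x k \<beta>\<bar>)"
      using that(2) by (intro member_le_sum) auto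
    also have "\<dots> \<le> b"
      unfolding b_def using that(1) B(1) by (intro member_le_sum[of \<beta> B "\<lambda>\<beta>. \<Sum>k<n. nat \<bar>x k \<beta>\<bar>"]) auto
    also have "b < N"
      using zexp_pos by (cases zexp) (simp_all add: N_def)
    finally have "\<bar>x k \<beta>\<bar> < int N" by linarith
    also have "int N \<le> \<bar>q\<bar>" using D mult_left_mono[of 1 "\<bar>D\<bar>" "int N"] by (simp add: q_def abs_mult)
    finally show ?thesis .
  qed
  have N_pow: "c [^] (int N * i) = (c [^] (int (Suc b) * i)) [^] zexp" if "c \<in> carrier A" for c and i :: int
  proof -
    have "(c [^] (int (Suc b) * i)) [^] zexp = (c [^] (int (Suc b) * i)) [^] int zexp"
      by (simp add: int_pow_int)
    also have "\<dots> = c [^] (int (Suc b) * i * int zexp)"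
      using that by (simp add: int_pow_pow)
    also have "int (Suc b) * i * int zexp = int N * i"
      by (simp add: N_def algebra_simps)
    finally show ?thesis by simp
  qed
  have pow_Z: "c [^] k \<in> Z x q \<longleftrightarrow> int N dvd k"
    if c: "c \<in> carrier A" "j < n" "s \<in> {1, -1}" "\<forall>k<n. x k c = (if k = j then s * D else 0)" for c j s k
  proof
    assume "c [^] k \<in> Z x q"
    then have "q dvd x j (c [^] k)" using c(2) by (auto simp: Z_def)
    then have "int N * D dvd k * (s * D)" using c by (simp add: x_int_pow q_def)
    then have "int N * D dvd k * D" using c(3) by auto
    then show "int N dvd k" using D by simp
  next
    assume "int N dvd k"
    then obtain i where k: "k = int N * i" by (elim dvdE)
    have "q dvd x k' (c [^] k)" if "k' < n" for k'
      using c that by (simp add: x_int_pow k q_def)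
    moreover have "c [^] k = (c [^] (int (Suc b) * i)) [^] zexp" using N_pow[OF c(1)] k by simp
    ultimately show "c [^] k \<in> Z x q"
      unfolding Z_def using c(1) by (intro CollectI exI[of _ "c [^] (int (Suc b) * i)"]) auto
  qed
  have sep: "c [^] k \<otimes> \<beta> \<notin> Z x q"
    if c: "c \<in> carrier A" "j < n" "s \<in> {1, -1}" "\<forall>k<n. x k c = (if k = j then s * D else 0)"
      and \<beta>: "\<beta> \<in> B" and no: "\<forall>k::int. \<beta> \<noteq> c [^] k" for c j s \<beta> and k :: int
  proof
    assume mem: "c [^] k \<otimes> \<beta> \<in> Z x q"
    have \<beta>c: "\<beta> \<in> carrier A" using \<beta> B by blast
    obtain \<gamma> where \<gamma>: "\<gamma> \<in> carrier A" "c [^] k \<otimes> \<beta> = \<gamma> [^] zexp" "\<forall>l<n. q dvd x l (c [^] k \<otimes> \<beta>)"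
      using mem by (auto simp: Z_def)
    \<comment> \<open>Off the axis the values are divisible by \<open>q\<close> but smaller than it
      in absolute value.\<close>
    have off: "x l (c [^] k \<otimes> \<beta>) = 0" if l: "l < n" "l \<noteq> j" for l
    proof -
      have "x l (c [^] k \<otimes> \<beta>) = x l \<beta>" using l c \<beta>c by (simp add: x_mult x_int_pow)
      moreover have "q dvd x l \<beta>" using \<gamma>(3) l(1) calculation by metis
      then have "x l \<beta> = 0" using bound[OF \<beta> l(1)] by (metis dvd_imp_le_int leD)
      ultimately show ?thesis by simp
    qed
    obtain i where i: "x j (c [^] k \<otimes> \<beta>) = q * i" using \<gamma>(3) c(2) by (auto elim: dvdE)
    \<comment> \<open>\<open>w\<close> is the power of \<open>c\<close> in \<open>Z x q\<close> with
      the same functionals as \<open>c [^] k \<otimes> \<beta>\<close>; the factor \<open>s\<close>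
      compensates the sign of \<open>c\<close> on its axis.\<close>
    let ?\<delta> = "c [^] (int (Suc b) * (s * i))"
    define w where "w = c [^] (int N * (s * i))"
    have w: "w = ?\<delta> [^] zexp" unfolding w_def by (rule N_pow[OF c(1)])
    have wc: "w \<in> carrier A" using c(1) by (simp add: w_def)
    have ss: "s * s = 1" using c(3) by auto
    have xw: "x l w = x l (c [^] k \<otimes> \<beta>)" if l: "l < n" for l
    proof (cases "l = j")
      case True
      have "x j w = int N * (s * i) * x j c"
        unfolding w_def by (rule x_int_pow[OF c(2,1)])
      also have "x j c = s * D" using c(2,4) by simp
      also have "int N * (s * i) * (s * D) = (s * s) * (q * i)"
        by (simp only: q_def ac_simps)
      finally show ?thesis using True i ss by simp
    next
      case False
      then have "x l c = 0" using c(4) l by simp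
      then show ?thesis using off[OF l False] x_int_pow[OF l c(1)] by (simp add: w_def)
    qed
    \<comment> \<open>The quotient is again a \<open>zexp\<close>-th power, and all functionals
      vanish on it, so it is trivial. This makes \<open>\<beta>\<close> a power of
      \<open>c\<close>.\<close>
    have prod: "(\<gamma> \<otimes> inv ?\<delta>) [^] zexp = (c [^] k \<otimes> \<beta>) \<otimes> inv w"
      using \<gamma>(1,2) c(1) by (simp add: zexp_pow_mult w nat_pow_inv)
    have "x l ((c [^] k \<otimes> \<beta>) \<otimes> inv w) = 0" if "l < n" for l
      using x_mult[OF that, of "c [^] k \<otimes> \<beta>" "inv w"] x_inv[OF that wc] xw[OF that] wc c(1) \<beta>c
      by simp
    then have "\<forall>l<n. x l ((\<gamma> \<otimes> inv ?\<delta>) [^] zexp) = 0"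
      by (simp only: prod) blast
    moreover have "\<gamma> \<otimes> inv ?\<delta> \<in> carrier A" using \<gamma>(1) c(1) by simp
    ultimately have "(\<gamma> \<otimes> inv ?\<delta>) [^] zexp = \<one>" by (intro pow_in_H_eq_one)
    then have one: "(c [^] k \<otimes> \<beta>) \<otimes> inv w = \<one>" using prod by simp
    have "c [^] k \<otimes> \<beta> = (c [^] k \<otimes> \<beta>) \<otimes> inv w \<otimes> w"
      using wc c(1) \<beta>c by (simp add: m_assoc)
    also have "\<dots> = w" unfolding one using wc by simp
    finally have w_eq: "c [^] k \<otimes> \<beta> = w" .
    have "\<beta> = inv (c [^] k) \<otimes> (c [^] k \<otimes> \<beta>)"
      using c(1) \<beta>c by (simp flip: m_assoc)
    then have "\<beta> = inv (c [^] k) \<otimes> w" by (simp only: w_eq)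
    also have "\<dots> = c [^] (- k + int N * (s * i))"
      using c(1) by (simp only: w_def int_pow_mult int_pow_neg)
    finally show False using no by blast
  qed
  have "\<forall>c. axial D c \<longrightarrow> (\<forall>k::int. c [^] k \<in> Z x q \<longleftrightarrow> int N dvd k)"
    unfolding axial_def by (intro allI impI) (elim conjE exE bexE, rule pow_Z)
  moreover have "\<forall>c. axial D c \<longrightarrow>
      (\<forall>\<beta>\<in>B. (\<forall>k::int. \<beta> \<noteq> c [^] k) \<longrightarrow> (\<forall>k::int. c [^] k \<otimes> \<beta> \<notin> Z x q))"
    unfolding axial_def by (intro allI impI ballI) (elim conjE exE bexE, rule sep)
  ultimately show ?thesis
    using Z_normal Z_finite_index[OF q] Z_inter_H N by (intro exI[of _ "Z x q"] exI[of _ N] conjI)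
qed

end

section \<open>Equivariant matchings\<close>

text \<open>All cycles of \<open>f\<close> on \<open>\<Omega>\<close> have length exactly
  \<open>N\<close>.\<close>

definition free_period :: "('w \<Rightarrow> 'w) \<Rightarrow> 'w set \<Rightarrow> nat \<Rightarrow> bool" where
  "free_period f \<Omega> N \<longleftrightarrow> f permutes \<Omega> \<and> N > 0 \<and> (\<forall>x\<in>\<Omega>. \<forall>k. (f ^^ k) x = x \<longleftrightarrow> N dvd k)"

lemma funpow_in:
  assumes "f permutes \<Omega>" "x \<in> \<Omega>"
  shows "(f ^^ k) x \<in> \<Omega>"
  using assms by (induction k) (simp_all add: permutes_in_image)

text \<open>A forward iterate serves as the inverse of another one, so integer powers of functions
  are avoided.\<close>

lemma free_period_unwind:
  assumes f: "free_period f \<Omega> N" and x: "x \<in> \<Omega>"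
  shows "(f ^^ ((N - 1) * k)) ((f ^^ k) x) = x"
proof -
  have "(N - 1) * k + k = N * k"
    using f by (cases N) (simp_all add: free_period_def)
  then have "(f ^^ ((N - 1) * k)) ((f ^^ k) x) = (f ^^ (N * k)) x"
    by (metis comp_apply funpow_add)
  then show ?thesis using f x by (simp add: free_period_def)
qed

text \<open>Equal cycle lengths make the map from the \<open>k\<close>-th iterate of
  \<open>x\<close> to the \<open>k\<close>-th iterate of \<open>y\<close> well defined.\<close>

lemma free_period_transfer:
  assumes f: "free_period f \<Omega> N" "x \<in> \<Omega>" and g: "free_period g \<Omega> N" "y \<in> \<Omega>"
    and eq: "(f ^^ j) x = (f ^^ k) x"
  shows "(g ^^ j) y = (g ^^ k) y"
proof -
  let ?i = "(N - 1) * k + j"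
  have "(f ^^ ?i) x = x"
    using free_period_unwind[OF f, of k] eq by (simp add: funpow_add)
  then have "N dvd ?i" using f by (simp add: free_period_def)
  then have "(g ^^ ?i) y = y" using g by (simp add: free_period_def)
  then have "(g ^^ k) y = (g ^^ k) ((g ^^ ((N - 1) * k)) ((g ^^ j) y))"
    by (simp add: funpow_add)
  also have "\<dots> = (g ^^ ((N - 1) * k)) ((g ^^ k) ((g ^^ j) y))"
    by (metis add.commute comp_apply funpow_add)
  also have "\<dots> = (g ^^ j) y"
    using g by (intro free_period_unwind[where \<Omega> = \<Omega>]) (auto simp: free_period_def intro: funpow_in)
  finally show ?thesis by simp
qed

text \<open>\<open>P\<close> is a partial injection from cycles of \<open>f\<close> to cycles of
  \<open>g\<close>, with a base point chosen on each.\<close>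

definition orbit_separated :: "('w \<Rightarrow> 'w) \<Rightarrow> ('w \<Rightarrow> 'w) \<Rightarrow> ('w \<times> 'w) set \<Rightarrow> bool" where
  "orbit_separated f g P \<longleftrightarrow> (\<forall>x y x' y' k. (x, y) \<in> P \<longrightarrow> (x', y') \<in> P \<longrightarrow> (x, y) \<noteq> (x', y') \<longrightarrow>
     (f ^^ k) x \<noteq> x' \<and> (g ^^ k) y \<noteq> y')"

text \<open>The graph of the equivariant extension of \<open>P\<close> along the cycles.\<close>

definition orbit_pairs :: "('w \<Rightarrow> 'w) \<Rightarrow> ('w \<Rightarrow> 'w) \<Rightarrow> ('w \<times> 'w) set \<Rightarrow> ('w \<times> 'w) set" where
  "orbit_pairs f g P = {((f ^^ k) x, (g ^^ k) y) | k x y. (x, y) \<in> P}"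

text \<open>By this symmetry, injectivity of the extension is functionality of its converse.\<close>

lemma orbit_pairs_swap: "(u, v) \<in> orbit_pairs f g P \<longleftrightarrow> (v, u) \<in> orbit_pairs g f (P\<inverse>)"
  by (auto simp: orbit_pairs_def)

lemma orbit_separated_swap:
  assumes "orbit_separated f g P"
  shows "orbit_separated g f (P\<inverse>)"
  unfolding orbit_separated_def
proof (intro allI impI)
  fix x y x' y' k
  assume "(x, y) \<in> P\<inverse>" "(x', y') \<in> P\<inverse>" "(x, y) \<noteq> (x', y')"
  then have "(y, x) \<in> P" "(y', x') \<in> P" "(y, x) \<noteq> (y', x')" by auto
  then show "(g ^^ k) x \<noteq> x' \<and> (f ^^ k) y \<noteq> y'"
    using assms unfolding orbit_separated_def by blast
qed

text \<open>Two base points whose cycles contain \<open>u\<close> coincide by separation; equal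
  periods then give the same partner.\<close>

lemma orbit_pairs_functional:
  assumes f: "free_period f \<Omega> N" and g: "free_period g \<Omega> N" and P: "P \<subseteq> \<Omega> \<times> \<Omega>"
    and sep: "orbit_separated f g P"
    and uv: "(u, v) \<in> orbit_pairs f g P" "(u, v') \<in> orbit_pairs f g P"
  shows "v = v'"
proof -
  obtain k x y where xy: "u = (f ^^ k) x" "v = (g ^^ k) y" "(x, y) \<in> P"
    using uv(1) by (auto simp: orbit_pairs_def)
  obtain k' x' y' where xy': "u = (f ^^ k') x'" "v' = (g ^^ k') y'" "(x', y') \<in> P"
    using uv(2) by (auto simp: orbit_pairs_def)
  have in\<Omega>: "x \<in> \<Omega>" "y \<in> \<Omega>" "x' \<in> \<Omega>" using xy xy' P by auto
  have "(f ^^ ((N - 1) * k' + k)) x = x'"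
    using free_period_unwind[OF f in\<Omega>(3), of k'] xy(1) xy'(1) by (simp add: funpow_add)
  then have "(x, y) = (x', y')" using sep xy(3) xy'(3) unfolding orbit_separated_def by blast
  then show ?thesis
    using free_period_transfer[OF f in\<Omega>(1) g in\<Omega>(2), of k k'] xy xy' by simp
qed

text \<open>As all cycles have the same length, a partial matching of cycles can be enlarged until
  it is complete, matched cycles being aligned at their base points.\<close>

lemma equivariant_matching:
  assumes fin: "finite \<Omega>" and f: "free_period f \<Omega> N" and g: "free_period g \<Omega> N"
    and P: "P \<subseteq> \<Omega> \<times> \<Omega>" "orbit_separated f g P"
  obtains \<tau> where "\<tau> permutes \<Omega>" "\<tau> \<circ> f = g \<circ> \<tau>" "\<And>x y. (x, y) \<in> P \<Longrightarrow> \<tau> x = y"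
proof -
  let ?C = "{P. P \<subseteq> \<Omega> \<times> \<Omega> \<and> orbit_separated f g P}"
  have "finite ?C" by (rule finite_subset[of _ "Pow (\<Omega> \<times> \<Omega>)"]) (use fin in auto)
  then obtain R where R: "R \<in> ?C" "P \<subseteq> R" and max: "\<forall>R'\<in>?C. R \<subseteq> R' \<longrightarrow> R = R'"
    using finite_has_maximal2[of ?C P] P by blast
  define T where "T = orbit_pairs f g R"
  have f\<Omega>: "f permutes \<Omega>" and g\<Omega>: "g permutes \<Omega>" using f g by (simp_all add: free_period_def)
  have RT: "R \<subseteq> T"
    unfolding T_def orbit_pairs_def by (auto intro!: exI[of _ 0])
  have T\<Omega>: "T \<subseteq> \<Omega> \<times> \<Omega>"
    using R(1) funpow_in[OF f\<Omega>] funpow_in[OF g\<Omega>] by (auto simp: T_def orbit_pairs_def)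
  have funT: "v = v'" if "(u, v) \<in> T" "(u, v') \<in> T" for u v v'
    using orbit_pairs_functional[OF f g] R(1) that by (auto simp: T_def)
  have injT: "u = u'" if "(u, v) \<in> T" "(u', v) \<in> T" for u u' v
  proof (rule orbit_pairs_functional[OF g f])
    show "R\<inverse> \<subseteq> \<Omega> \<times> \<Omega>" "orbit_separated g f (R\<inverse>)"
      using R(1) orbit_separated_swap by auto
    show "(v, u) \<in> orbit_pairs g f (R\<inverse>)" "(v, u') \<in> orbit_pairs g f (R\<inverse>)"
      using that by (simp_all add: T_def orbit_pairs_swap[symmetric])
  qed
  have stepT: "(f u, g v) \<in> T" if uv: "(u, v) \<in> T" for u v
  proof -
    obtain k x y where "u = (f ^^ k) x" "v = (g ^^ k) y" "(x, y) \<in> R"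
      using uv by (auto simp: T_def orbit_pairs_def)
    then show ?thesis
      unfolding T_def orbit_pairs_def by (intro CollectI exI[of _ "Suc k"] exI[of _ x] exI[of _ y]) simp
  qed
  have powT: "((f ^^ k) u, (g ^^ k) v) \<in> T" if "(u, v) \<in> T" for u v k
    using that by (induction k) (simp_all add: stepT)
  \<comment> \<open>The identity is the default, so that nothing outside \<open>\<Omega>\<close>
    moves.\<close>
  define \<tau> where "\<tau> u = (if u \<in> Domain T then THE v. (u, v) \<in> T else u)" for u
  have \<tau>: "\<tau> u = v" if "(u, v) \<in> T" for u v
    using that funT unfolding \<tau>_def by (auto intro!: the_equality)
  have inj\<tau>: "inj_on \<tau> (Domain T)"
  proof (rule inj_onI)
    fix u u' assume "u \<in> Domain T" "u' \<in> Domain T" and eq: "\<tau> u = \<tau> u'"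
    then obtain v v' where v: "(u, v) \<in> T" "(u', v') \<in> T" by blast
    then have "v = v'" using eq \<tau> by simp
    then show "u = u'" using v injT by blast
  qed
  have im\<tau>: "\<tau> ` Domain T = Range T"
    using \<tau> by (force simp: image_iff)
  \<comment> \<open>\<open>T\<close> is a bijection from its domain to its range. If the domain
    misses a point of \<open>\<Omega>\<close>, then by counting so does the range, and such a pair
    could be added to the maximal \<open>R\<close>.\<close>
  have dom: "Domain T = \<Omega>"
  proof (rule ccontr)
    assume ne: "Domain T \<noteq> \<Omega>"
    have sub: "Domain T \<subseteq> \<Omega>" "Range T \<subseteq> \<Omega>" using T\<Omega> by auto
    have "card (Range T) = card (Domain T)" using card_image[OF inj\<tau>] im\<tau> by simp
    also have "\<dots> < card \<Omega>" using ne sub fin by (intro psubset_card_mono) auto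
    finally have "Range T \<noteq> \<Omega>" by auto
    then obtain x y where x: "x \<in> \<Omega>" "x \<notin> Domain T" and y: "y \<in> \<Omega>" "y \<notin> Range T"
      using ne sub by blast
    \<comment> \<open>\<open>T\<close> is closed under iteration, and further iteration returns to
      the start, so the cycle of an unmatched point avoids \<open>T\<close>.\<close>
    have fx: "(f ^^ k) x \<noteq> x'" and xf: "(f ^^ k) x' \<noteq> x"
      and gy: "(g ^^ k) y \<noteq> y'" and yg: "(g ^^ k) y' \<noteq> y" if "(x', y') \<in> R" for k x' y'
    proof -
      have T: "((f ^^ j) x', (g ^^ j) y') \<in> T" for j using that RT powT by blast
      show "(f ^^ k) x' \<noteq> x" "(g ^^ k) y' \<noteq> y" using T[of k] x(2) y(2) by auto
      show "(f ^^ k) x \<noteq> x'"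
        using free_period_unwind[OF f x(1), of k] T[of "(N - 1) * k"] x(2) by auto
      show "(g ^^ k) y \<noteq> y'"
        using free_period_unwind[OF g y(1), of k] T[of "(N - 1) * k"] y(2) by auto
    qed
    have "orbit_separated f g (insert (x, y) R)"
      unfolding orbit_separated_def
    proof (intro allI impI)
      fix x1 y1 x2 y2 k
      assume "(x1, y1) \<in> insert (x, y) R" "(x2, y2) \<in> insert (x, y) R" and neq: "(x1, y1) \<noteq> (x2, y2)"
      then consider "(x1, y1) \<in> R" "(x2, y2) \<in> R" | "x1 = x" "y1 = y" "(x2, y2) \<in> R"
        | "(x1, y1) \<in> R" "x2 = x" "y2 = y" by auto
      then show "(f ^^ k) x1 \<noteq> x2 \<and> (g ^^ k) y1 \<noteq> y2"
      proof cases
        case 1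
        then show ?thesis using R(1) neq unfolding orbit_separated_def by blast
      qed (simp_all add: fx xf gy yg)
    qed
    moreover have "insert (x, y) R \<subseteq> \<Omega> \<times> \<Omega>" using R(1) x y by auto
    ultimately have "R = insert (x, y) R" using max by blast
    then have "(x, y) \<in> T" using RT by blast
    then show False using x(2) by blast
  qed
  have "Range T \<subseteq> \<Omega>" using T\<Omega> by auto
  then have "\<tau> ` \<Omega> = \<Omega>"
    using endo_inj_surj[OF fin, of \<tau>] inj\<tau> im\<tau> dom by simp
  then have "bij_betw \<tau> \<Omega> \<Omega>" using inj\<tau> dom by (simp add: bij_betw_def)
  then have "\<tau> permutes \<Omega>"
    by (rule bij_imp_permutes) (simp add: \<tau>_def dom)
  moreover have "\<tau> \<circ> f = g \<circ> \<tau>"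
  proof
    fix u
    show "(\<tau> \<circ> f) u = (g \<circ> \<tau>) u"
    proof (cases "u \<in> \<Omega>")
      case True
      then obtain v where v: "(u, v) \<in> T" using dom by blast
      then show ?thesis using \<tau>[OF v] \<tau>[OF stepT[OF v]] by simp
    next
      case False
      then show ?thesis using f\<Omega> g\<Omega> dom by (simp add: permutes_not_in \<tau>_def)
    qed
  qed
  moreover have "\<tau> x = y" if "(x, y) \<in> P" for x y
    using that R(2) RT \<tau> by blast
  ultimately show ?thesis using that by blast
qed

text \<open>Left multiplication on \<open>r\<close> copies of \<open>Q\<close>, extended by the
  identity as \<open>permutes\<close> demands.\<close>

definition copies_mult :: "('q, 'b) monoid_scheme \<Rightarrow> nat \<Rightarrow> 'q \<Rightarrow> nat \<times> 'q \<Rightarrow> nat \<times> 'q" where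
  "copies_mult Q r q = (\<lambda>(s, c). if s < r \<and> c \<in> carrier Q then (s, q \<otimes>\<^bsub>Q\<^esub> c) else (s, c))"

context group
begin

lemma copies_mult_apply:
  "s < r \<Longrightarrow> c \<in> carrier G \<Longrightarrow> copies_mult G r q (s, c) = (s, q \<otimes> c)"
  by (simp add: copies_mult_def)

lemma copies_mult_comp:
  assumes "p \<in> carrier G" "q \<in> carrier G"
  shows "copies_mult G r (p \<otimes> q) = copies_mult G r p \<circ> copies_mult G r q"
  using assms by (auto simp: copies_mult_def fun_eq_iff m_assoc)

lemma copies_mult_one: "copies_mult G r \<one> = id"
  by (auto simp: copies_mult_def fun_eq_iff)

lemma copies_mult_permutes:
  assumes "q \<in> carrier G"
  shows "copies_mult G r q permutes ({..<r} \<times> carrier G)"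
proof (rule bij_imp_permutes)
  have "copies_mult G r q \<circ> copies_mult G r (inv q) = id"
    "copies_mult G r (inv q) \<circ> copies_mult G r q = id"
    using assms by (simp_all add: copies_mult_comp[symmetric] copies_mult_one)
  then show "bij_betw (copies_mult G r q) ({..<r} \<times> carrier G) ({..<r} \<times> carrier G)"
    using assms
    by (intro bij_betw_byWitness[where f' = "copies_mult G r (inv q)"])
       (auto simp: fun_eq_iff copies_mult_apply m_assoc[symmetric])
qed (auto simp: copies_mult_def split: if_splits)

lemma copies_mult_hom: "copies_mult G r \<in> hom G (perm_group ({..<r} \<times> carrier G))"
  by (rule homI) (simp_all add: copies_mult_permutes copies_mult_comp)

lemma copies_mult_pow:
  assumes "q \<in> carrier G" "s < r" "c \<in> carrier G"
  shows "(copies_mult G r q ^^ k) (s, c) = (s, q [^] k \<otimes> c)"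
proof (induction k)
  case 0
  then show ?case using assms by simp
next
  case (Suc k)
  have "q \<otimes> (q [^] k \<otimes> c) = q [^] Suc k \<otimes> c"
    using assms nat_pow_Suc2[of q k] by (simp add: m_assoc[symmetric])
  then show ?case using Suc assms by (simp add: copies_mult_apply)
qed

text \<open>Left multiplication is free, so every cycle is as long as the order of
  \<open>q\<close>.\<close>

lemma copies_mult_free_period:
  assumes q: "q \<in> carrier G" and N: "N > 0" and ord: "\<And>k::nat. q [^] k = \<one> \<longleftrightarrow> N dvd k"
  shows "free_period (copies_mult G r q) ({..<r} \<times> carrier G) N"
  unfolding free_period_def
proof (intro conjI ballI allI)
  fix y k assume "y \<in> {..<r} \<times> carrier G"
  then obtain s c where y: "y = (s, c)" "s < r" "c \<in> carrier G" by auto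
  then have "(copies_mult G r q ^^ k) y = y \<longleftrightarrow> q [^] k \<otimes> c = c"
    using q by (simp add: copies_mult_pow)
  also have "\<dots> \<longleftrightarrow> q [^] k = \<one>"
    using q y by simp
  finally show "(copies_mult G r q ^^ k) y = y \<longleftrightarrow> N dvd k" by (simp add: ord)
qed (use N copies_mult_permutes[OF q] in auto)

end

section \<open>Cyclic subgroups of the HNN-extension\<close>

locale axial_hnn = dual_functionals A H n \<xi> x + hnn_extension A m a b
  for A :: "('a, 'c) monoid_scheme" (structure) and H n \<xi> x m a b +
  fixes D :: int
  assumes D: "D \<noteq> 0"
    and a_axial: "i \<in> {1..m} \<Longrightarrow> axial D (a i)"
    and b_axial: "i \<in> {1..m} \<Longrightarrow> axial D (b i)"
begin

text \<open>The signed functionals \<open>\<plusminus> x k\<close>. As \<open>a\<^sub>i\<close> and \<open>b\<^sub>i\<close> are axial, a signed transposition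
  carries the values at \<open>a\<^sub>i\<close> to the values at \<open>b\<^sub>i\<close>, so \<open>A\<close> acts by translations and \<open>t\<^sub>i\<close>
  by that transposition.\<close>

definition signed :: "'a \<Rightarrow> bool \<times> nat \<Rightarrow> int" where
  "signed \<beta> = (\<lambda>(e, k). if k < n then (if e then x k \<beta> else - x k \<beta>) else 0)"

lemma signed_matching:
  assumes "axial D c" "axial D c'"
  obtains \<sigma> where "\<sigma> permutes (UNIV \<times> {..<n})" "\<And>\<omega>. signed c' (\<sigma> \<omega>) = signed c \<omega>"
proof -
  obtain j s where c: "j < n" "s \<in> {1, -1}" "\<forall>k<n. x k c = (if k = j then s * D else 0)"
    using assms(1) unfolding axial_def by blast
  obtain j' s' where c': "j' < n" "s' \<in> {1, -1}" "\<forall>k<n. x k c' = (if k = j' then s' * D else 0)"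
    using assms(2) unfolding axial_def by blast
  \<comment> \<open>If the signs differ, they are flipped at every index. Away from \<open>j\<close>
    and \<open>j'\<close> this is harmless, since both elements have value 0 there.\<close>
  define \<sigma> where "\<sigma> = (\<lambda>(e, k). if k < n then (if s = s' then e else \<not> e, Transposition.transpose j j' k)
    else (e, k))"
  have tr: "Transposition.transpose j j' k < n \<longleftrightarrow> k < n" for k
    using c(1) c'(1) by (auto simp: Transposition.transpose_def)
  have "\<sigma> \<circ> \<sigma> = id"
    by (auto simp: fun_eq_iff \<sigma>_def tr)
  then have "bij_betw \<sigma> (UNIV \<times> {..<n}) (UNIV \<times> {..<n})"
    by (intro bij_betw_byWitness[where f' = \<sigma>]) (auto simp: fun_eq_iff, auto simp: \<sigma>_def tr)
  then have "\<sigma> permutes (UNIV \<times> {..<n})"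
    by (rule bij_imp_permutes) (auto simp: \<sigma>_def split: if_splits)
  moreover have "signed c' (\<sigma> \<omega>) = signed c \<omega>" for \<omega>
  proof (cases "snd \<omega> < n")
    case True
    obtain e k where \<omega>: "\<omega> = (e, k)" "k < n" using True by (cases \<omega>) auto
    have x: "x k c = (if k = j then s * D else 0)"
      "x (Transposition.transpose j j' k) c' = (if Transposition.transpose j j' k = j' then s' * D else 0)"
      using c(3) c'(3) \<omega>(2) tr[of k] by simp_all
    have "Transposition.transpose j j' k = j' \<longleftrightarrow> k = j"
      by (auto simp: Transposition.transpose_def)
    then show ?thesis
      using x \<omega>(2) tr[of k] c(2) c'(2) unfolding \<omega>(1)
      by (simp add: signed_def \<sigma>_def) auto
  next
    case False
    then show ?thesis by (cases \<omega>) (simp add: signed_def \<sigma>_def)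
  qed
  ultimately show ?thesis by (rule that)
qed

text \<open>A single functional need not extend to \<open>G\<close>, but the permuted family of
  signed functionals defines an action; over \<open>(True, k)\<close> the element
  \<open>\<alpha>\<close> translates by \<open>x k \<alpha>\<close>.\<close>

lemma virtual_retract_base_infinite:
  assumes \<alpha>: "\<alpha> \<in> carrier A" and k: "k < n" "x k \<alpha> \<noteq> 0"
  shows "virtual_retract G (generate G {\<iota> \<alpha>})"
proof -
  let ?\<Omega> = "UNIV \<times> {..<n} :: (bool \<times> nat) set"
  let ?S = "shift_group ?\<Omega>"
  define \<theta> where "\<theta> \<beta> = shift_perm id (signed \<beta>)" for \<beta>
  have "\<forall>i\<in>{1..m}. \<exists>\<sigma>. \<sigma> permutes ?\<Omega> \<and> (\<forall>\<omega>. signed (b i) (\<sigma> \<omega>) = signed (a i) \<omega>)"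
    using signed_matching a_axial b_axial by metis
  then obtain \<sigma> where \<sigma>: "\<And>i. i \<in> {1..m} \<Longrightarrow> \<sigma> i permutes ?\<Omega>"
    "\<And>i \<omega>. i \<in> {1..m} \<Longrightarrow> signed (b i) (\<sigma> i \<omega>) = signed (a i) \<omega>"
    by metis
  have \<theta>_hom: "\<theta> \<in> hom A ?S"
  proof (rule homI)
    show "\<theta> \<beta> \<in> carrier ?S" for \<beta> unfolding \<theta>_def by (rule shift_perm_in_carrier[OF permutes_id])
    show "\<theta> (\<beta> \<otimes> \<gamma>) = \<theta> \<beta> \<otimes>\<^bsub>?S\<^esub> \<theta> \<gamma>" if "\<beta> \<in> carrier A" "\<gamma> \<in> carrier A" for \<beta> \<gamma>
      using that by (auto simp: \<theta>_def shift_perm_comp signed_def fun_eq_iff x_mult)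
  qed
  obtain \<Phi> where \<Phi>: "\<Phi> \<in> hom G ?S" "\<And>\<beta>. \<beta> \<in> carrier A \<Longrightarrow> \<Phi> (\<iota> \<beta>) = \<theta> \<beta>"
  proof (rule lift[OF group_shift_group \<theta>_hom, where \<tau> = "\<lambda>i. shift_perm (\<sigma> i) (\<lambda>_. 0)"])
    fix i assume i: "i \<in> {1..m}"
    show "shift_perm (\<sigma> i) (\<lambda>_. 0) \<in> carrier ?S"
      using \<sigma>(1)[OF i] by (rule shift_perm_in_carrier)
    show "shift_perm (\<sigma> i) (\<lambda>_. 0) \<otimes>\<^bsub>?S\<^esub> \<theta> (a i) = \<theta> (b i) \<otimes>\<^bsub>?S\<^esub> shift_perm (\<sigma> i) (\<lambda>_. 0)"
      using \<sigma>(2)[OF i] by (simp add: \<theta>_def shift_perm_comp)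
  qed blast
  show ?thesis
  proof (rule virtual_retract_shift_action[OF G.is_group \<Phi>(1)])
    show "\<iota> \<alpha> \<in> carrier G" using \<alpha> by simp
    show "\<Phi> (\<iota> \<alpha>) ((True, k), 0) = ((True, k), x k \<alpha>)"
      using \<Phi>(2)[OF \<alpha>] k by (simp add: \<theta>_def signed_def)
  qed (use k in auto)
qed

text \<open>The separating quotient acts on any number of copies of itself. One period
  \<open>N\<close> for all axial elements is what allows the cycles of \<open>a i\<close> and
  \<open>b i\<close> to be matched.\<close>

lemma finite_quotient:
  assumes "finite B" "B \<subseteq> carrier A"
  shows "\<exists>(Q :: 'a set monoid) \<theta> M N. group Q \<and> finite (carrier Q) \<and> \<theta> \<in> hom A Q \<and>
    (\<forall>\<alpha>\<in>carrier A. \<theta> \<alpha> = \<one>\<^bsub>Q\<^esub> \<longleftrightarrow> \<alpha> \<in> M) \<and> M \<inter> H \<subseteq> {\<one>} \<and>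
    (\<forall>c r. axial D c \<longrightarrow> free_period (copies_mult Q r (\<theta> c)) ({..<r} \<times> carrier Q) N) \<and>
    (\<forall>c. axial D c \<longrightarrow> (\<forall>\<beta>\<in>B. (\<forall>k::int. \<beta> \<noteq> c [^] k) \<longrightarrow> (\<forall>k::int. c [^] k \<otimes> \<beta> \<notin> M)))"
proof -
  obtain M and N :: nat where M: "M \<lhd> A" "finite (rcosets M)" "M \<inter> H \<subseteq> {\<one>}" and N: "N > 0"
    and ord: "\<forall>c. axial D c \<longrightarrow> (\<forall>k::int. c [^] k \<in> M \<longleftrightarrow> int N dvd k)"
    and sep: "\<forall>c. axial D c \<longrightarrow> (\<forall>\<beta>\<in>B. (\<forall>k::int. \<beta> \<noteq> c [^] k) \<longrightarrow> (\<forall>k::int. c [^] k \<otimes> \<beta> \<notin> M))"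
    using separating_quotient[OF D assms] by auto
  interpret M: normal M A by (rule M(1))
  let ?Q = "A Mod M" and ?\<theta> = "\<lambda>\<alpha>. M #> \<alpha>"
  have Q: "group ?Q" by (rule M.factorgroup_is_group)
  interpret Q: group ?Q by (rule Q)
  have \<theta>: "?\<theta> \<in> hom A ?Q" by (rule M.r_coset_hom_Mod)
  interpret \<theta>: group_hom A ?Q ?\<theta> using \<theta> by unfold_locales
  have one: "?\<theta> \<alpha> = \<one>\<^bsub>?Q\<^esub> \<longleftrightarrow> \<alpha> \<in> M" if "\<alpha> \<in> carrier A" for \<alpha>
    using that M.rcos_const coset_join1[OF _ that M.is_subgroup] by (auto simp: FactGroup_def)
  have period: "free_period (copies_mult ?Q r (?\<theta> c)) ({..<r} \<times> carrier ?Q) N" if c: "axial D c" for r c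
  proof (rule Q.copies_mult_free_period[OF _ N])
    have cc: "c \<in> carrier A" using c by (simp add: axial_def)
    then show "?\<theta> c \<in> carrier ?Q" by simp
    show "?\<theta> c [^]\<^bsub>?Q\<^esub> k = \<one>\<^bsub>?Q\<^esub> \<longleftrightarrow> N dvd k" for k :: nat
    proof -
      have "?\<theta> c [^]\<^bsub>?Q\<^esub> k = ?\<theta> (c [^] k)" using \<theta>.hom_nat_pow[OF cc, of k] by simp
      also have "\<dots> = \<one>\<^bsub>?Q\<^esub> \<longleftrightarrow> c [^] int k \<in> M" using one[of "c [^] k"] cc by (simp add: int_pow_int)
      also have "\<dots> \<longleftrightarrow> N dvd k" using ord c by simp
      finally show ?thesis .
    qed
  qed
  have "finite (carrier ?Q)" using M(2) by (simp add: FactGroup_def)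
  then show ?thesis
    using Q \<theta> one M(3) period sep
    by (intro exI[of _ ?Q] exI[of _ ?\<theta>] exI[of _ M] exI[of _ N] conjI ballI) simp_all
qed

text \<open>\<open>G\<close> acts on a single copy of a finite quotient in which \<open>H\<close>
  embeds, so the powers of \<open>\<alpha>\<close> are detected in a finite permutation
  group.\<close>

lemma virtual_retract_base_finite:
  assumes \<alpha>: "\<alpha> \<in> H"
  shows "virtual_retract G (generate G {\<iota> \<alpha>})"
proof -
  have \<alpha>c: "\<alpha> \<in> carrier A" using \<alpha> by (simp add: mem_H)
  obtain Q :: "'a set monoid" and \<theta> M N where Q: "group Q" "finite (carrier Q)" and \<theta>: "\<theta> \<in> hom A Q"
    and ker: "\<forall>\<alpha>\<in>carrier A. \<theta> \<alpha> = \<one>\<^bsub>Q\<^esub> \<longleftrightarrow> \<alpha> \<in> M" and M: "M \<inter> H \<subseteq> {\<one>}"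
    and period: "\<forall>c r. axial D c \<longrightarrow> free_period (copies_mult Q r (\<theta> c)) ({..<r} \<times> carrier Q) N"
    using finite_quotient[OF finite.emptyI empty_subsetI] by blast
  interpret Q: group Q by fact
  interpret \<theta>: group_hom A Q \<theta> using \<theta> by unfold_locales
  let ?\<Omega> = "{..<1::nat} \<times> carrier Q"
  let ?S = "perm_group ?\<Omega>"
  have fin: "finite ?\<Omega>" using Q(2) by simp
  define \<theta>' where "\<theta>' = copies_mult Q 1 \<circ> \<theta>"
  have \<theta>': "\<theta>' \<in> hom A ?S"
    unfolding \<theta>'_def using \<theta> Q.copies_mult_hom by (rule Group.hom_compose)
  \<comment> \<open>No pair is prescribed; any matching of the cycles serves.\<close>
  have "\<exists>\<tau>. \<tau> permutes ?\<Omega> \<and> \<tau> \<circ> \<theta>' (a i) = \<theta>' (b i) \<circ> \<tau>" if "i \<in> {1..m}" for i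
    using equivariant_matching[OF fin period[rule_format, OF a_axial[OF that]]
        period[rule_format, OF b_axial[OF that]], of "{}"]
    by (auto simp: orbit_separated_def \<theta>'_def)
  then obtain \<tau> where \<tau>: "\<And>i. i \<in> {1..m} \<Longrightarrow> \<tau> i permutes ?\<Omega>"
    "\<And>i. i \<in> {1..m} \<Longrightarrow> \<tau> i \<circ> \<theta>' (a i) = \<theta>' (b i) \<circ> \<tau> i"
    by metis
  obtain \<Phi> where \<Phi>: "\<Phi> \<in> hom G ?S" "\<And>\<beta>. \<beta> \<in> carrier A \<Longrightarrow> \<Phi> (\<iota> \<beta>) = \<theta>' \<beta>"
    by (rule lift[OF group_perm_group \<theta>', of \<tau>]) (use \<tau> in auto)
  interpret S: group ?S by (rule group_perm_group)
  interpret \<Phi>: group_hom G ?S \<Phi> using \<Phi>(1) by unfold_locales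
  show ?thesis
  proof (rule virtual_retract_pullback[OF G.is_group S.is_group \<Phi>(1)])
    show \<iota>c: "\<iota> \<alpha> \<in> carrier G" using \<alpha>c by simp
    have "finite (carrier ?S)" using finite_permutations[OF fin] by simp
    then show "virtual_retract ?S (generate ?S {\<Phi> (\<iota> \<alpha>)})"
      using \<Phi>.hom_closed[OF \<iota>c] by (intro S.virtual_retract_finite S.generate_is_subgroup) blast+
    fix k :: int
    assume k: "\<Phi> (\<iota> \<alpha>) [^]\<^bsub>?S\<^esub> k = \<one>\<^bsub>?S\<^esub>"
    have \<alpha>k: "\<alpha> [^] k \<in> carrier A" using \<alpha>c by simp
    have "\<theta>' (\<alpha> [^] k) = \<one>\<^bsub>?S\<^esub>"
      using k \<Phi>.hom_int_pow[OF \<iota>c, of k] \<iota>.hom_int_pow[OF \<alpha>c, of k] \<Phi>(2)[OF \<alpha>k] by simp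
    then have "copies_mult Q 1 (\<theta> (\<alpha> [^] k)) (0, \<one>\<^bsub>Q\<^esub>) = (0, \<one>\<^bsub>Q\<^esub>)"
      by (simp add: \<theta>'_def)
    then have "\<theta> (\<alpha> [^] k) = \<one>\<^bsub>Q\<^esub>"
      using \<theta>.hom_closed[OF \<alpha>k] by (simp add: Q.copies_mult_apply)
    then have "\<alpha> [^] k \<in> M" using ker \<alpha>k by blast
    moreover have "\<alpha> [^] k \<in> H" using \<alpha> \<alpha>c by (simp add: mem_H \<xi>_int_pow)
    ultimately have "\<alpha> [^] k = \<one>" using M by blast
    then show "\<iota> \<alpha> [^]\<^bsub>G\<^esub> k = \<one>\<^bsub>G\<^esub>"
      using \<iota>.hom_int_pow[OF \<alpha>c, of k] by simp
  qed
qed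

lemma virtual_retract_base:
  assumes "\<alpha> \<in> carrier A"
  shows "virtual_retract G (generate G {\<iota> \<alpha>})"
proof (cases "\<exists>k<n. x k \<alpha> \<noteq> 0")
  case True
  then show ?thesis using virtual_retract_base_infinite assms by blast
next
  case False
  then show ?thesis using virtual_retract_base_finite x_kernel[OF assms] by blast
qed

text \<open>A cyclically reduced element \<open>g\<close> with \<open>r\<close> syllables is made to walk once around a cycle of
  \<open>r\<close> copies of a finite quotient of \<open>A\<close>. Cyclic reducedness says precisely that the partial
  matchings of orbits prescribed by the walk are injective, so they extend to permutations
  \<open>\<tau> i\<close>; counting the signed passages through the edge of the first syllable yields a
  character of a point stabiliser whose value at \<open>g\<close> is \<open>\<plusminus>1\<close>.\<close>

lemma virtual_retract_cyc_reduced: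
  assumes l: "l \<in> syls" "l \<noteq> []" and red: "cyc_reduced l"
  shows "virtual_retract G (generate G {val l})"
proof -
  define r where "r = length l"
  have r: "r > 0" using l(2) by (simp add: r_def)
  define ix where "ix s = fst (l ! s)" for s
  define sg where "sg s = fst (snd (l ! s))" for s
  define al where "al s = snd (snd (l ! s))" for s
  have nth: "l ! s = (ix s, sg s, al s)" for s by (simp add: ix_def sg_def al_def)
  have ix: "ix s \<in> {1..m}" and al: "al s \<in> carrier A" if "s < r" for s
  proof -
    have "l ! s \<in> {1..m} \<times> UNIV \<times> carrier A" using l(1) that by (auto simp: r_def)
    then show "ix s \<in> {1..m}" "al s \<in> carrier A" by (auto simp: nth)
  qed
  let ?B = "al ` {..<r}"
  have B: "finite ?B" "?B \<subseteq> carrier A" using al by auto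
  obtain Q :: "'a set monoid" and \<theta> M N where Q: "group Q" "finite (carrier Q)" and \<theta>: "\<theta> \<in> hom A Q"
    and ker: "\<forall>\<alpha>\<in>carrier A. \<theta> \<alpha> = \<one>\<^bsub>Q\<^esub> \<longleftrightarrow> \<alpha> \<in> M"
    and period: "\<forall>c r. axial D c \<longrightarrow> free_period (copies_mult Q r (\<theta> c)) ({..<r} \<times> carrier Q) N"
    and sep: "\<forall>c. axial D c \<longrightarrow> (\<forall>\<beta>\<in>?B. (\<forall>k::int. \<beta> \<noteq> c [^] k) \<longrightarrow> (\<forall>k::int. c [^] k \<otimes> \<beta> \<notin> M))"
    using finite_quotient[OF B] by blast
  interpret Q: group Q by fact
  interpret \<theta>: group_hom A Q \<theta> using \<theta> by unfold_locales
  let ?\<Omega> = "{..<r} \<times> carrier Q"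
  have fin: "finite ?\<Omega>" using Q(2) by simp
  let ?L = "\<lambda>\<beta>. copies_mult Q r (\<theta> \<beta>)"

  \<comment> \<open>The cycle of copies and the prescribed edges\<close>
  define nx where "nx s = Suc s mod r" for s
  have nx: "nx s < r" for s using r by (simp add: nx_def)
  have nx_eq: "nx s = (if Suc s = r then 0 else Suc s)" if "s < r" for s
    using that by (auto simp: nx_def)
  have nx_inj: "s = s'" if "nx s = nx s'" "s < r" "s' < r" for s s'
    using that nx_eq[of s] nx_eq[of s'] by (auto split: if_splits)
  \<comment> \<open>The right end of the word acts first, so syllable \<open>s\<close> has to carry
    the base point of copy \<open>nx s\<close> to that of copy \<open>s\<close>. Multiplication by
    \<open>al s\<close> leads to \<open>edge_from s\<close>, and the stable letter must send this to
    \<open>edge_to s\<close>. A negative sign reverses the edge seen by the positive letter, whence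
    \<open>src\<close> and \<open>tgt\<close>.\<close>
  define edge_from where "edge_from s = (nx s, \<theta> (al s))" for s
  define edge_to where "edge_to s = (s, \<one>\<^bsub>Q\<^esub>)" for s :: nat
  define src where "src s = (if sg s then edge_from s else edge_to s)" for s
  define tgt where "tgt s = (if sg s then edge_to s else edge_from s)" for s
  have from\<Omega>: "edge_from s \<in> ?\<Omega>" and to\<Omega>: "edge_to s \<in> ?\<Omega>" if "s < r" for s
    using that nx[of s] al[OF that] by (simp_all add: edge_from_def edge_to_def)
  have st\<Omega>: "src s \<in> ?\<Omega>" "tgt s \<in> ?\<Omega>" if "s < r" for s
    using from\<Omega>[OF that] to\<Omega>[OF that] by (simp_all add: src_def tgt_def)
  have ab: "axial D (a i)" "axial D (b i)" "a i \<in> carrier A" "b i \<in> carrier A" if "i \<in> {1..m}" for i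
    using that a_axial b_axial a_closed b_closed by auto
  have pow: "(?L c ^^ k) (s, q) = (s, \<theta> c [^]\<^bsub>Q\<^esub> k \<otimes>\<^bsub>Q\<^esub> q)"
    if "c \<in> carrier A" "s < r" "q \<in> carrier Q" for c k s q
    using Q.copies_mult_pow that by simp

  \<comment> \<open>When a letter is followed by its inverse, both edges have an end on the same
    side in copy \<open>nx s\<close>, at \<open>\<theta> (al s)\<close> and at the identity. Without
    a pinch \<open>al s\<close> is no power of \<open>c\<close>, and the quotient keeps these points
    on different cycles of \<open>c\<close>.\<close>
  have turn: "\<theta> c [^]\<^bsub>Q\<^esub> k \<otimes>\<^bsub>Q\<^esub> \<theta> (al s) \<noteq> \<one>\<^bsub>Q\<^esub> \<and> \<theta> c [^]\<^bsub>Q\<^esub> k \<noteq> \<theta> (al s)"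
    if s: "s < r" and i: "ix (nx s) = ix s" and e: "sg (nx s) \<noteq> sg s"
      and c: "c = (if sg s then a (ix s) else b (ix s))" for s c and k :: nat
  proof -
    have cA: "c \<in> carrier A" and cax: "axial D c" using c ab[OF ix[OF s]] by auto
    have "\<not> cancels (l ! s) (l ! nx s)"
      using red s by (simp add: cyc_reduced_def r_def nx_def)
    then have "\<forall>k::int. al s \<noteq> c [^] k"
      using i e unfolding cancels_def nth c by auto
    then have no: "c [^] j \<otimes> al s \<notin> M" for j :: int
      using sep cax s by blast
    have no': "\<theta> (c [^] j) \<otimes>\<^bsub>Q\<^esub> \<theta> (al s) \<noteq> \<one>\<^bsub>Q\<^esub>" for j :: int
      using no[of j] ker cA al[OF s] by (metis \<theta>.hom_mult int_pow_closed m_closed)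
    have "\<theta> c [^]\<^bsub>Q\<^esub> k = \<theta> (c [^] int k)"
      using \<theta>.hom_nat_pow[OF cA, of k] by (simp add: int_pow_int)
    moreover have "\<theta> c [^]\<^bsub>Q\<^esub> k \<noteq> \<theta> (al s)"
    proof
      assume "\<theta> c [^]\<^bsub>Q\<^esub> k = \<theta> (al s)"
      then have eq: "\<theta> (al s) = \<theta> (c [^] int k)" using calculation by simp
      have "\<theta> (c [^] (- int k)) \<otimes>\<^bsub>Q\<^esub> \<theta> (al s) = \<theta> (c [^] (- int k) \<otimes> c [^] int k)"
        unfolding eq using cA by simp
      also have "c [^] (- int k) \<otimes> c [^] int k = \<one>"
        using cA by (simp flip: int_pow_mult)
      finally show False using no'[of "- int k"] by simp
    qed
    ultimately show ?thesis using no'[of "int k"] by simp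
  qed

  \<comment> \<open>With equal signs the sources lie in different copies, and so do the targets.
    With opposite signs two ends share a copy only if one syllable follows the other, which is the
    case of \<open>turn\<close>.\<close>
  have distinct: "(?L (a i) ^^ k) (src s) \<noteq> src s' \<and> (?L (b i) ^^ k) (tgt s) \<noteq> tgt s'"
    if s: "s < r" "s' < r" "s \<noteq> s'" and i: "ix s = i" "ix s' = i" for s s' i k
  proof -
    have iI: "i \<in> {1..m}" using ix[OF s(1)] i by simp
    note c = ab(3,4)[OF iI]
    have one: "\<theta> c [^]\<^bsub>Q\<^esub> k \<otimes>\<^bsub>Q\<^esub> \<one>\<^bsub>Q\<^esub> = \<theta> c [^]\<^bsub>Q\<^esub> k" if "c \<in> carrier A" for c
      using that by simp
    note p = pow[OF c(1) nx \<theta>.hom_closed[OF al[OF s(1)]], of k s]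
      pow[OF c(2) nx \<theta>.hom_closed[OF al[OF s(1)]], of k s]
      pow[OF c(1) s(1) Q.one_closed, of k] pow[OF c(2) s(1) Q.one_closed, of k]
    show ?thesis
    proof (cases "sg s = sg s'")
      case True
      then show ?thesis
        using nx_inj[OF _ s(1,2)] s(3) p by (cases "sg s'") (auto simp: src_def tgt_def edge_from_def edge_to_def)
    next
      case False
      have 1: "\<theta> c [^]\<^bsub>Q\<^esub> k \<otimes>\<^bsub>Q\<^esub> \<theta> (al s) \<noteq> \<one>\<^bsub>Q\<^esub>"
        if "nx s = s'" "c = (if sg s then a i else b i)" for c
        using turn[OF s(1), of c k] that i False by auto
      have 2: "\<theta> c [^]\<^bsub>Q\<^esub> k \<noteq> \<theta> (al s')"
        if "nx s' = s" "c = (if sg s' then a i else b i)" for c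
        using turn[OF s(2), of c k] that i False by auto
      show ?thesis
      proof (cases "sg s")
        case True
        then show ?thesis
          using False 1[of "a i"] 2[of "b i"] p one c
          by (auto simp: src_def tgt_def edge_from_def edge_to_def)
      next
        case False
        then show ?thesis
          using \<open>sg s \<noteq> sg s'\<close> 1[of "b i"] 2[of "a i"] p one c
          by (auto simp: src_def tgt_def edge_from_def edge_to_def)
      qed
    qed
  qed

  \<comment> \<open>Permutations for the stable letters\<close>
  have "\<exists>\<tau>. \<tau> permutes ?\<Omega> \<and> \<tau> \<circ> ?L (a i) = ?L (b i) \<circ> \<tau> \<and>
      (\<forall>s<r. ix s = i \<longrightarrow> \<tau> (src s) = tgt s)" if i: "i \<in> {1..m}" for i
  proof -
    let ?P = "(\<lambda>s. (src s, tgt s)) ` {s. s < r \<and> ix s = i}"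
    have sub: "?P \<subseteq> ?\<Omega> \<times> ?\<Omega>"
      by (intro image_subsetI SigmaI[of "src _" ?\<Omega>] st\<Omega>) simp_all
    have "orbit_separated (?L (a i)) (?L (b i)) ?P"
      unfolding orbit_separated_def
    proof (intro allI impI)
      fix x y x' y' k assume "(x, y) \<in> ?P" "(x', y') \<in> ?P" and neq: "(x, y) \<noteq> (x', y')"
      then obtain s s' where "s < r" "ix s = i" "x = src s" "y = tgt s"
        "s' < r" "ix s' = i" "x' = src s'" "y' = tgt s'" by blast
      moreover have "s \<noteq> s'" using neq calculation by auto
      ultimately show "(?L (a i) ^^ k) x \<noteq> x' \<and> (?L (b i) ^^ k) y \<noteq> y'"
        using distinct[of s s' i k] by simp
    qed
    from equivariant_matching[OF fin period[rule_format, OF ab(1)[OF i]]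
        period[rule_format, OF ab(2)[OF i]] sub this]
    obtain \<tau> where "\<tau> permutes ?\<Omega>" "\<tau> \<circ> ?L (a i) = ?L (b i) \<circ> \<tau>"
      "\<And>x y. (x, y) \<in> ?P \<Longrightarrow> \<tau> x = y" by blast
    then show ?thesis by (intro exI[of _ \<tau>]) auto
  qed
  then obtain \<tau> where \<tau>: "\<And>i. i \<in> {1..m} \<Longrightarrow> \<tau> i permutes ?\<Omega>"
    "\<And>i. i \<in> {1..m} \<Longrightarrow> \<tau> i \<circ> ?L (a i) = ?L (b i) \<circ> \<tau> i"
    and \<tau>_edge: "\<And>s. s < r \<Longrightarrow> \<tau> (ix s) (src s) = tgt s"
    using ix by metis

  \<comment> \<open>\<open>cr\<close> marks the edge of the first syllable. The whole cycle of
    \<open>a i\<close> through its source is marked, since the counting must be invariant under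
    \<open>a i\<close> for the relation to hold.\<close>
  define cr where "cr i \<omega> = (if i = ix 0 \<and> (\<exists>k. \<omega> = (?L (a i) ^^ k) (src 0)) then 1 else 0 :: int)"
    for i \<omega>
  have cr_inv: "cr i (?L (a i) \<omega>) = cr i \<omega>" if i: "i \<in> {1..m}" for i \<omega>
  proof (cases "\<omega> \<in> ?\<Omega>")
    case True
    have "(\<exists>k. ?L (a i) \<omega> = (?L (a i) ^^ k) (src 0)) \<longleftrightarrow> (\<exists>k. \<omega> = (?L (a i) ^^ k) (src 0))"
    proof
      assume "\<exists>k. \<omega> = (?L (a i) ^^ k) (src 0)"
      then obtain k where "\<omega> = (?L (a i) ^^ k) (src 0)" by blast
      then have "?L (a i) \<omega> = (?L (a i) ^^ Suc k) (src 0)" by simp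
      then show "\<exists>k. ?L (a i) \<omega> = (?L (a i) ^^ k) (src 0)" by blast
    next
      assume "\<exists>k. ?L (a i) \<omega> = (?L (a i) ^^ k) (src 0)"
      then obtain k where k: "?L (a i) \<omega> = (?L (a i) ^^ k) (src 0)" by blast
      have "\<omega> = (?L (a i) ^^ (N - 1)) (?L (a i) \<omega>)"
        using free_period_unwind[OF period[rule_format, OF ab(1)[OF i]] True, of 1] by simp
      also have "\<dots> = (?L (a i) ^^ (N - 1 + k)) (src 0)" by (simp add: k funpow_add)
      finally show "\<exists>k. \<omega> = (?L (a i) ^^ k) (src 0)" by blast
    qed
    then show ?thesis by (simp add: cr_def)
  next
    case False
    then have "?L (a i) \<omega> = \<omega>" by (cases \<omega>) (auto simp: copies_mult_def)
    then show ?thesis by simp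
  qed
  \<comment> \<open>By \<open>distinct\<close> no other syllable with this letter has its source on
    the marked cycle.\<close>
  have cr_edge: "cr (ix s) (src s) = (if s = 0 then 1 else 0)" if s: "s < r" for s
  proof (cases "s = 0")
    case True
    then show ?thesis by (auto simp: cr_def intro: exI[of _ 0])
  next
    case False
    have "src s \<noteq> (?L (a (ix s)) ^^ k) (src 0)" if "ix s = ix 0" for k
      using distinct[of 0 s "ix s" k] r s False that by auto
    then show ?thesis using False by (auto simp: cr_def)
  qed

  \<comment> \<open>The action on copies of \<open>Q\<close> times the integers\<close>
  let ?S = "shift_group ?\<Omega>"
  interpret S: group ?S by (rule group_shift_group)
  \<comment> \<open>Base elements do not translate; only stable letters count crossings.\<close>
  define \<theta>' where "\<theta>' \<beta> = shift_perm (?L \<beta>) (\<lambda>_. 0)" for \<beta>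
  define T where "T i = shift_perm (\<tau> i) (cr i)" for i
  have \<theta>'c: "\<theta>' \<beta> \<in> carrier ?S" if "\<beta> \<in> carrier A" for \<beta>
    unfolding \<theta>'_def using that by (intro shift_perm_in_carrier Q.copies_mult_permutes) simp
  have \<theta>': "\<theta>' \<in> hom A ?S"
    by (rule homI) (simp_all add: \<theta>'c, simp add: \<theta>'_def shift_perm_comp Q.copies_mult_comp)
  have Tc: "T i \<in> carrier ?S" if "i \<in> {1..m}" for i
    unfolding T_def using \<tau>(1)[OF that] by (rule shift_perm_in_carrier)
  have T_rel: "T i \<otimes>\<^bsub>?S\<^esub> \<theta>' (a i) = \<theta>' (b i) \<otimes>\<^bsub>?S\<^esub> T i" if "i \<in> {1..m}" for i
    using \<tau>(2)[OF that] cr_inv[OF that] by (simp add: T_def \<theta>'_def shift_perm_comp)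
  obtain \<Phi> where \<Phi>: "\<Phi> \<in> hom G ?S" "\<And>\<beta>. \<beta> \<in> carrier A \<Longrightarrow> \<Phi> (\<iota> \<beta>) = \<theta>' \<beta>"
    "\<And>i. i \<in> {1..m} \<Longrightarrow> \<Phi> (t i) = T i"
    by (rule lift[OF group_shift_group \<theta>' Tc T_rel]) blast+
  have val: "\<Phi> (val l) = syl_val ?S \<theta>' T l"
    by (rule hom_syl_val[OF group_shift_group \<Phi> l(1)])

  have syl_step: "((if sg s then T (ix s) else inv\<^bsub>?S\<^esub> T (ix s)) \<circ> \<theta>' (al s)) ((nx s, \<one>\<^bsub>Q\<^esub>), z)
      = ((s, \<one>\<^bsub>Q\<^esub>), z + (if s = 0 then (if sg 0 then 1 else -1) else 0))" if s: "s < r" for s z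
  proof -
    have \<theta>z: "\<theta>' (al s) ((nx s, \<one>\<^bsub>Q\<^esub>), z) = (edge_from s, z)"
      using al[OF s] nx[of s] by (simp add: \<theta>'_def Q.copies_mult_apply edge_from_def)
    have Tz: "T (ix s) (src s, y) = (tgt s, y + (if s = 0 then 1 else 0))" for y
      using \<tau>_edge[OF s] cr_edge[OF s] by (simp add: T_def)
    show ?thesis
    proof (cases "sg s")
      case True
      then show ?thesis
        using \<theta>z Tz[of z] by (cases "s = 0") (auto simp: src_def tgt_def edge_to_def)
    next
      case False
      have "(inv\<^bsub>?S\<^esub> T (ix s)) (T (ix s) p) = p" for p
        using S.l_inv[OF Tc[OF ix[OF s]]] by (metis comp_apply id_apply shift_group_simps)
      \<comment> \<open>The inverse subtracts at the target what \<open>T\<close> adds at the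
        source.\<close>
      from this[of "(src s, z - (if s = 0 then 1 else 0))"]
      have "(inv\<^bsub>?S\<^esub> T (ix s)) (tgt s, z) = (src s, z - (if s = 0 then 1 else 0))"
        unfolding Tz by simp
      then show ?thesis
        using False \<theta>z by (cases "s = 0") (auto simp: src_def tgt_def edge_to_def)
    qed
  qed
  \<comment> \<open>The induction runs downwards from \<open>r\<close>, as the end of the word acts
    first. Modulo \<open>r\<close> the walk starts in copy 0, and it returns there through syllable
    0, the only one that translates.\<close>
  have walk: "syl_val ?S \<theta>' T (drop s l) ((0, \<one>\<^bsub>Q\<^esub>), 0)
      = ((s mod r, \<one>\<^bsub>Q\<^esub>), if s = 0 then (if sg 0 then 1 else -1) else 0)" if "s \<le> r" for s
    using that
  proof (induction s rule: inc_induct)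
    case base
    then show ?case using r by (simp add: r_def)
  next
    case (step s)
    have "drop s l = (ix s, sg s, al s) # drop (Suc s) l"
      using Cons_nth_drop_Suc[of s l] step.hyps unfolding nth[of s] by (simp add: r_def)
    then have "syl_val ?S \<theta>' T (drop s l) ((0, \<one>\<^bsub>Q\<^esub>), 0)
        = ((if sg s then T (ix s) else inv\<^bsub>?S\<^esub> T (ix s)) \<circ> \<theta>' (al s))
            (syl_val ?S \<theta>' T (drop (Suc s) l) ((0, \<one>\<^bsub>Q\<^esub>), 0))"
      by simp
    also have "syl_val ?S \<theta>' T (drop (Suc s) l) ((0, \<one>\<^bsub>Q\<^esub>), 0) = ((nx s, \<one>\<^bsub>Q\<^esub>), 0)"
      using step.IH by (simp add: nx_def)
    finally show ?case
      using syl_step[OF \<open>s < r\<close>, of 0] \<open>s < r\<close> by simp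
  qed
  show ?thesis
  proof (rule virtual_retract_shift_action[OF G.is_group \<Phi>(1) _ fin])
    show "val l \<in> carrier G" using l(1) by simp
    show "(0, \<one>\<^bsub>Q\<^esub>) \<in> ?\<Omega>" using r by simp
    show "\<Phi> (val l) ((0, \<one>\<^bsub>Q\<^esub>), 0) = ((0, \<one>\<^bsub>Q\<^esub>), if sg 0 then 1 else -1)"
      using walk[of 0] by (simp add: val)
  qed simp
qed

lemma VRC_hnn: "VRC G"
  unfolding VRC_def
proof
  fix g assume "g \<in> carrier G"
  show "virtual_retract G (generate G {g})"
    by (rule conj_cases[where P = "\<lambda>g. virtual_retract G (generate G {g})",
          OF G.virtual_retract_conj virtual_retract_base virtual_retract_cyc_reduced \<open>g \<in> carrier G\<close>])
qed

end

theorem theorem9p5: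
  fixes A :: "('a, 'c) monoid_scheme"
    and H :: "'a set"
    and n m :: nat
    and \<phi> :: "'a set \<Rightarrow> nat \<Rightarrow> int"
    and \<xi> :: "'a \<Rightarrow> nat \<Rightarrow> int"
    and a b :: "nat \<Rightarrow> 'a"
  assumes "group A"
    and "H \<lhd> A" and "finite H"
    and "\<phi> \<in> iso (A Mod H) (int_lattice n)"
    and "\<And>x. x \<in> carrier A \<Longrightarrow> \<xi> x = \<phi> (H #>\<^bsub>A\<^esub> x)"
    and "\<And>i. i \<in> {1..m} \<Longrightarrow> a i \<in> carrier A \<and> group.ord A (a i) = 0"
    and "\<And>i. i \<in> {1..m} \<Longrightarrow> b i \<in> carrier A \<and> group.ord A (b i) = 0"
    and "nearly_lin_indep n (Sum_Type.Plus {1..m} {1..m})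
           (case_sum (\<lambda>i. real_vec_of n (\<xi> (a i))) (\<lambda>i. real_vec_of n (\<xi> (b i))))"
  shows "VRC (multiple_HNN A m a b)"
proof -
  interpret A: group A by fact
  interpret H: normal H A by fact
  have lattice: "group (int_lattice n)"
    unfolding int_lattice_def by simp
  interpret \<phi>: group_hom "A Mod H" "int_lattice n" \<phi>
    using assms(4) H.factorgroup_is_group lattice
    by (simp add: group_hom_def group_hom_axioms_def iso_def)
  have \<xi>: "\<xi> x = \<phi> (H #>\<^bsub>A\<^esub> x)" if "x \<in> carrier A" for x using assms(5) that .
  have coset: "H #>\<^bsub>A\<^esub> x \<in> carrier (A Mod H)" if "x \<in> carrier A" for x
    using that by (auto simp: FactGroup_def RCOSETS_def)
  have \<xi>_mult: "\<xi> (x \<otimes>\<^bsub>A\<^esub> y) k = \<xi> x k + \<xi> y k" if "k < n" "x \<in> carrier A" "y \<in> carrier A" for k x y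
  proof -
    have "\<phi> (H #>\<^bsub>A\<^esub> (x \<otimes>\<^bsub>A\<^esub> y)) = \<phi> (H #>\<^bsub>A\<^esub> x) \<otimes>\<^bsub>int_lattice n\<^esub> \<phi> (H #>\<^bsub>A\<^esub> y)"
      using \<phi>.hom_mult[OF coset[OF that(2)] coset[OF that(3)]] that by (simp add: FactGroup_def H.rcos_sum)
    then show ?thesis using that by (simp add: \<xi> int_lattice_def)
  qed
  have \<phi>_bij: "bij_betw \<phi> (carrier (A Mod H)) (carrier (int_lattice n))"
    using assms(4) by (simp add: iso_def)
  have lat: "carrier (int_lattice n) = PiE {..<n} (\<lambda>_. UNIV)" "\<one>\<^bsub>int_lattice n\<^esub> = (\<lambda>i\<in>{..<n}. 0)"
    by (simp_all add: int_lattice_def)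
  have kernel: "x \<in> H \<longleftrightarrow> (\<forall>k<n. \<xi> x k = 0)" if x: "x \<in> carrier A" for x
  proof -
    have one: "\<one>\<^bsub>A Mod H\<^esub> = H" by (simp add: FactGroup_def)
    have "x \<in> H \<longleftrightarrow> H #>\<^bsub>A\<^esub> x = H"
      using A.coset_join1[OF _ x H.is_subgroup] H.rcos_const[OF A.is_group, of x] by (intro iffI)
    also have "\<dots> \<longleftrightarrow> \<phi> (H #>\<^bsub>A\<^esub> x) = \<one>\<^bsub>int_lattice n\<^esub>"
    proof
      show "\<phi> (H #>\<^bsub>A\<^esub> x) = \<one>\<^bsub>int_lattice n\<^esub>" if "H #>\<^bsub>A\<^esub> x = H"
        using \<phi>.hom_one that unfolding one by (simp only:)
      assume "\<phi> (H #>\<^bsub>A\<^esub> x) = \<one>\<^bsub>int_lattice n\<^esub>"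
      then have "\<phi> (H #>\<^bsub>A\<^esub> x) = \<phi> \<one>\<^bsub>A Mod H\<^esub>" using \<phi>.hom_one by (simp only:)
      then have "H #>\<^bsub>A\<^esub> x = \<one>\<^bsub>A Mod H\<^esub>"
        by (rule inj_onD[OF bij_betw_imp_inj_on[OF \<phi>_bij] _ coset[OF x]])
          (rule monoid.one_closed[OF group.is_monoid[OF H.factorgroup_is_group]])
      then show "H #>\<^bsub>A\<^esub> x = H" using one by (simp only:)
    qed
    \<comment> \<open>Elements of the product group are extensional, so the coordinates below
      \<open>n\<close> determine them.\<close>
    also have "\<dots> \<longleftrightarrow> (\<forall>k<n. \<xi> x k = 0)"
    proof -
      have "\<phi> (H #>\<^bsub>A\<^esub> x) \<in> PiE {..<n} (\<lambda>_. UNIV)"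
        using \<phi>.hom_closed[OF coset[OF x]] lat by simp
      then show ?thesis unfolding \<xi>[OF x] lat(2)
        by (auto simp: fun_eq_iff PiE_def extensional_def)
    qed
    finally show ?thesis .
  qed
  have surj: "\<exists>x\<in>carrier A. \<forall>k<n. \<xi> x k = u k" for u
  proof -
    have "restrict u {..<n} \<in> carrier (int_lattice n)" by (simp add: lat)
    then obtain C where C: "C \<in> carrier (A Mod H)" "\<phi> C = restrict u {..<n}"
      using bij_betw_imp_surj_on[OF \<phi>_bij] by (metis imageE)
    then obtain x where "x \<in> carrier A" "C = H #>\<^bsub>A\<^esub> x" by (auto simp: FactGroup_def RCOSETS_def)
    then show ?thesis using C \<xi> by (intro bexI[of _ x]) auto
  qed
  \<comment> \<open>Both families are joined over the disjoint sum, so that one system of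
    functionals and one \<open>D\<close> serve all \<open>a i\<close> and
    \<open>b i\<close>.\<close>
  let ?v = "case_sum (\<lambda>i. \<xi> (a i)) (\<lambda>i. \<xi> (b i))"
  have "(\<lambda>i. real_vec_of n (?v i)) = case_sum (\<lambda>i. real_vec_of n (\<xi> (a i))) (\<lambda>i. real_vec_of n (\<xi> (b i)))"
    by (auto simp: fun_eq_iff split: sum.split)
  then have "nearly_lin_indep n (Sum_Type.Plus {1..m} {1..m}) (\<lambda>i. real_vec_of n (?v i))"
    using assms(8) by simp
  then have "\<exists>X D. D \<noteq> (0::int) \<and>
      (\<forall>i\<in>Sum_Type.Plus {1..m} {1..m}.
        \<exists>j<n. \<exists>s\<in>{1, -1}. \<forall>k<n. (\<Sum>l<n. X k l * ?v i l) = (if k = j then s * D else 0)) \<and>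
      (\<forall>u. (\<forall>k<n. (\<Sum>l<n. X k l * u l) = 0) \<longrightarrow> (\<forall>l<n. u l = 0))"
    by (rule nearly_lin_indep_dual) simp
  then obtain X and D :: int where D: "D \<noteq> 0"
    and dual: "\<forall>i\<in>Sum_Type.Plus {1..m} {1..m}.
      \<exists>j<n. \<exists>s\<in>{1, -1}. \<forall>k<n. (\<Sum>l<n. X k l * ?v i l) = (if k = j then s * D else 0)"
    and inj: "\<forall>u. (\<forall>k<n. (\<Sum>l<n. X k l * u l) = 0) \<longrightarrow> (\<forall>l<n. u l = 0)"
    by (elim exE conjE) (rule that)
  \<comment> \<open>The functionals are the rows of \<open>X\<close> composed with the quotient map;
    as the rows have trivial joint kernel on integer vectors, the joint kernel in \<open>A\<close>
    is \<open>H\<close>.\<close>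
  interpret dual_functionals A H n "\<lambda>k x. \<xi> x k" "\<lambda>k x. \<Sum>l<n. X k l * \<xi> x l"
  proof
    show "H = {x \<in> carrier A. \<forall>k<n. \<xi> x k = 0}" using kernel H.subset by blast
    show "\<alpha> \<in> H" if "\<alpha> \<in> carrier A" "\<forall>k<n. (\<Sum>l<n. X k l * \<xi> \<alpha> l) = 0" for \<alpha>
      unfolding kernel[OF that(1)] using spec[OF inj, of "\<xi> \<alpha>"] that(2) by (rule mp)
    show "(\<Sum>l<n. X k l * \<xi> (\<alpha> \<otimes>\<^bsub>A\<^esub> \<beta>) l) = (\<Sum>l<n. X k l * \<xi> \<alpha> l) + (\<Sum>l<n. X k l * \<xi> \<beta> l)"
      if "\<alpha> \<in> carrier A" "\<beta> \<in> carrier A" for k \<alpha> \<beta>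
      using that by (simp add: \<xi>_mult sum.distrib distrib_left)
    show "finite H" by fact
    show "\<xi> (x \<otimes>\<^bsub>A\<^esub> y) k = \<xi> x k + \<xi> y k" if "k < n" "x \<in> carrier A" "y \<in> carrier A" for k x y
      by (rule \<xi>_mult[OF that])
    show "\<exists>x\<in>carrier A. \<forall>k<n. \<xi> x k = u k" for u by (rule surj)
  qed
  interpret axial_hnn A H n "\<lambda>k x. \<xi> x k" "\<lambda>k x. \<Sum>l<n. X k l * \<xi> x l" m a b D
  proof
    show "axial D (a i)" if "i \<in> {1..m}" for i
      using assms(6)[OF that] bspec[OF dual InlI[OF that]] by (simp add: axial_def)
    show "axial D (b i)" if "i \<in> {1..m}" for i
      using assms(7)[OF that] bspec[OF dual InrI[OF that]] by (simp add: axial_def)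
    show "a i \<in> carrier A" "b i \<in> carrier A" if "i \<in> {1..m}" for i
      using assms(6,7)[OF that] by simp_all
  qed (fact D)
  show ?thesis by (rule VRC_hnn)
qed

end
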